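(* Let $k$ be a field of characteristic zero, $R=k[x_1,\ldots,x_n]$, let $\mathbf f=f_1,\ldots,f_m\in R$ be forms, and let $A=k[\mathbf f]\subset R$. Let $\mathfrak{D}\subset\mathfrak{Z}\subset R^m=\sum_{j=1}^m R\,dT_j$ be the polar and the differential syzygy modules of $\mathbf f$, and let $\mathfrak{J}\subset A$ be the Jacobian ideal of $A$, with extension $\mathfrak{J}R\subset R$. Then $\mathfrak{J}R\subset\mathfrak{D}:_R\mathfrak{Z}$. Moreover, $\mathbf f$ is polarizable if and only if $\mathfrak{D}:_{R^m}\mathfrak{J}R=\mathfrak{D}$.
   Context: Let $P\subset k[T_1,\ldots,T_m]$ be the kernel of the $k$-algebra map $k[T_1,\ldots,T_m]\to R$, $T_j\mapsto f_j$, so $A\simeq k[T_1,\ldots,T_m]/P$. For $f\in R$ put $df=\sum_{i=1}^n\frac{\partial f}{\partial x_i}dx_i$ in the free $R$-module $\sum_{i=1}^n R\,dx_i$, and let $\mathcal{D}(\mathbf f)=\sum_{j=1}^m R\,df_j$. The differential syzygy module $\mathfrak{Z}$ is the kernel of the $R$-linear map $\sum_{j=1}^m R\,dT_j\to\mathcal{D}(\mathbf f)$, $dT_j\mapsto df_j$, where $\sum_j R\,dT_j$ is free with basis $dT_1,\ldots,dT_m$. The polar syzygy module $\mathfrak{D}$ is the $R$-submodule of $\sum_j R\,dT_j$ generated by the vectors $\sum_{j=1}^m\frac{\partial F}{\partial T_j}(\mathbf f)\,dT_j$, $F\in P$; by the chain rule $\mathfrak{D}\subset\mathfrak{Z}$.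 The sequence $\mathbf f$ is called polarizable if $\mathfrak{D}=\mathfrak{Z}$. The Jacobian ideal $\mathfrak{J}$ of $A$ is the ideal of $A$ generated by the images of the $g\times g$ minors of the Jacobian matrix of a set of generators of $P$, where $g$ is the height of $P$ (equivalently, the Fitting ideal of order $\dim A$ of $\Omega_{A/k}$). Notation: $\mathfrak{D}:_R\mathfrak{Z}=\{a\in R: a\mathfrak{Z}\subset\mathfrak{D}\}$ and $\mathfrak{D}:_{R^m}\mathfrak{J}R=\{v\in R^m: (\mathfrak{J}R)v\subset\mathfrak{D}\}$. *)

theory Defs
  imports
    "HOL-Analysis.Finite_Cartesian_Product"
    "HOL-Library.Poly_Mapping"
    "HOL-Library.Extended_Nat"
    "Jordan_Normal_Form.Determinant"
begin

no_notation vec_index (infixl \<open>$\<close> 100)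

text \<open>
  \<open>('v, 'k) mpoly\<close> is the polynomial ring over \<open>'k\<close> in variables indexed by \<open>'v\<close>: finitely supported
  coefficient functions on the exponent vectors. Its ideals are the submodules for multiplication,
  i.e. \<open>module.subspace (*)\<close>, and \<open>module.span (*) S\<close> is the ideal generated by \<open>S\<close>; likewise
  \<open>module.subspace (*s)\<close> and \<open>module.span (*s)\<close> for the free module \<open>R ^ 'm\<close>. Variables
  \<open>x\<^sub>1, \<dots>, x\<^sub>n\<close> are a finite, linearly ordered index type; the order only serves to make the
  polynomial ring an instance of \<open>idom\<close>.
\<close>

type_synonym ('v, 'k) mpoly = "('v \<Rightarrow>\<^sub>0 nat) \<Rightarrow>\<^sub>0 'k"

definition is_form :: "('v::finite, 'k::field_char_0) mpoly \<Rightarrow> bool" where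
  "is_form p \<longleftrightarrow> (\<exists>d. \<forall>t\<in>Poly_Mapping.keys p. (\<Sum>i\<in>UNIV. Poly_Mapping.lookup t i) = d)"

text \<open>Term by term, \<open>c x\<^sup>t \<mapsto> t\<^sub>i c x\<^sup>t / x\<^sub>i\<close>; where the subtraction of exponents truncates, the coefficient
  vanishes.\<close>

definition pderiv_var :: "'v \<Rightarrow> ('v::finite, 'k::field_char_0) mpoly \<Rightarrow> ('v, 'k) mpoly" where
  "pderiv_var i p =
    (\<Sum>t\<in>Poly_Mapping.keys p.
      Poly_Mapping.single (t - Poly_Mapping.single i 1)
        (of_nat (Poly_Mapping.lookup t i) * Poly_Mapping.lookup p t))"

text \<open>The \<open>k\<close>-algebra map \<open>k[T\<^sub>1, \<dots>, T\<^sub>m] \<rightarrow> R\<close>, \<open>T\<^sub>j \<mapsto> f\<^sub>j\<close>.\<close>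

definition psubst ::
    "('n::finite, 'k::field_char_0) mpoly ^ 'm \<Rightarrow> ('m::finite, 'k) mpoly \<Rightarrow> ('n, 'k) mpoly" where
  "psubst f F =
    (\<Sum>t\<in>Poly_Mapping.keys F.
      Poly_Mapping.single 0 (Poly_Mapping.lookup F t) * (\<Prod>j\<in>UNIV. (f $ j) ^ Poly_Mapping.lookup t j))"

definition gen_subalgebra :: "('n::finite, 'k::field_char_0) mpoly ^ 'm::finite \<Rightarrow> ('n, 'k) mpoly set" where
  "gen_subalgebra f = range (psubst f)"

definition relation_ideal :: "('n::finite, 'k::field_char_0) mpoly ^ 'm::finite \<Rightarrow> ('m, 'k) mpoly set" where
  "relation_ideal f = {F. psubst f F = 0}"

definition prime_ideal :: "'a::comm_ring_1 set \<Rightarrow> bool" where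
  "prime_ideal I \<longleftrightarrow> module.subspace (*) I \<and> I \<noteq> UNIV \<and> (\<forall>a b. a * b \<in> I \<longrightarrow> a \<in> I \<or> b \<in> I)"

definition height :: "'a::comm_ring_1 set \<Rightarrow> enat" where
  "height P = Sup {enat l | l. \<exists>C :: nat \<Rightarrow> 'a set.
    (\<forall>i\<le>l. prime_ideal (C i)) \<and> (\<forall>i<l. C i \<subset> C (Suc i)) \<and> C l = P}"

definition differential :: "('n::finite, 'k::field_char_0) mpoly \<Rightarrow> ('n, 'k) mpoly ^ 'n" where
  "differential p = (\<chi> i. pderiv_var i p)"

definition diff_syzygies ::
    "('n::finite, 'k::field_char_0) mpoly ^ 'm::finite \<Rightarrow> (('n, 'k) mpoly ^ 'm) set" where
  "diff_syzygies f = {v. (\<Sum>j\<in>UNIV. (v $ j) *s differential (f $ j)) = 0}"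

definition polar_syzygies ::
    "('n::finite, 'k::field_char_0) mpoly ^ 'm::finite \<Rightarrow> (('n, 'k) mpoly ^ 'm) set" where
  "polar_syzygies f =
    module.span (*s) ((\<lambda>F. \<chi> j. psubst f (pderiv_var j F)) ` relation_ideal f)"

definition polarizable :: "('n::finite, 'k::field_char_0) mpoly ^ 'm::finite \<Rightarrow> bool" where
  "polarizable f \<longleftrightarrow> polar_syzygies f = diff_syzygies f"

text \<open>The \<open>g \<times> g\<close> minors of the Jacobian matrix of a set \<open>G\<close> of polynomials. Rows and columns are
  selected by arbitrary injections, not increasing ones, which affects minors only up to sign.\<close>

definition jacobian_minors :: "nat \<Rightarrow> ('m::finite, 'k::field_char_0) mpoly set \<Rightarrow> ('m, 'k) mpoly set" where
  "jacobian_minors g G =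
    {Determinant.det (Matrix.mat g g (\<lambda>(a, b). pderiv_var (c b) (r a))) | r c.
      inj_on r {..<g} \<and> r ` {..<g} \<subseteq> G \<and> inj_on c {..<g}}"

definition ideal_of_subring :: "'a::comm_ring_1 set \<Rightarrow> 'a set \<Rightarrow> bool" where
  "ideal_of_subring A I \<longleftrightarrow>
    I \<subseteq> A \<and> 0 \<in> I \<and> (\<forall>x\<in>I. \<forall>y\<in>I. x + y \<in> I) \<and> (\<forall>a\<in>A. \<forall>x\<in>I. a * x \<in> I)"

text \<open>The Jacobian ideal of \<open>A = k[f]\<close>, computed from a set \<open>G\<close> of generators of the relation ideal
  \<open>P\<close>; \<open>A\<close> is identified with \<open>k[T\<^sub>1, \<dots>, T\<^sub>m] / P\<close>, so residue classes are images under \<open>psubst f\<close>.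
  The height of \<open>P\<close> is at most \<open>m\<close>, so \<open>the_enat\<close> is applied to a finite value.\<close>

definition jacobian_ideal ::
    "('n::finite, 'k::field_char_0) mpoly ^ 'm::finite \<Rightarrow> ('m, 'k) mpoly set \<Rightarrow> ('n, 'k) mpoly set" where
  "jacobian_ideal f G =
    ideal_of_subring (gen_subalgebra f) hull
      (psubst f ` jacobian_minors (the_enat (height (relation_ideal f))) G)"

definition colon_ideal :: "('a::comm_ring_1 ^ 'm::finite) set \<Rightarrow> ('a ^ 'm) set \<Rightarrow> 'a set" where
  "colon_ideal D Z = {a. \<forall>z\<in>Z. a *s z \<in> D}"

definition colon_module :: "('a::comm_ring_1 ^ 'm::finite) set \<Rightarrow> 'a set \<Rightarrow> ('a ^ 'm) set" where
  "colon_module D I = {v. \<forall>a\<in>I. a *s v \<in> D}"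

end

theory Submission
  imports Defs "HOL-Analysis.Cartesian_Space"
begin

text \<open>
  Let \<open>P\<close> be the relation ideal of \<open>f\<close>, let \<open>S\<close> be a set of indices such that \<open>f\<^sub>j\<close>, \<open>j \<in> S\<close>, is a maximal
  algebraically independent subfamily, and put \<open>g = m - |S|\<close>. Everything rests on three facts:
  the height of \<open>P\<close> is \<open>g\<close>, the differentials \<open>df\<^sub>j\<close>, \<open>j \<in> S\<close>, are linearly independent over \<open>R\<close>, and
  some \<open>g \<times> g\<close> minor of the Jacobian matrix of any generating set of \<open>P\<close> does not lie in \<open>P\<close>.

  Given these, let \<open>\<Delta>\<close> be a \<open>g \<times> g\<close> minor, evaluated at \<open>f\<close>, with rows \<open>w\<^sub>1, \<dots>, w\<^sub>g \<in> \<DD>\<close>, and let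
  \<open>z \<in> \<ZZ>\<close>. Cramer's rule gives coefficients \<open>r\<^sub>a\<close> such that \<open>u = \<Delta> z - \<Sum> r\<^sub>a w\<^sub>a\<close> vanishes on the \<open>g\<close>
  columns of the minor. If \<open>\<Delta>\<close> and \<open>u\<close> were nonzero, \<open>w\<^sub>1, \<dots>, w\<^sub>g, u\<close> would be \<open>g + 1\<close> independent elements
  of \<open>\<ZZ>\<close>, which has rank at most \<open>g\<close> because its only element supported on \<open>S\<close> is zero. So
  \<open>\<Delta> z \<in> \<DD>\<close>, which is the inclusion
  \<open>\<JJ>R \<subseteq> \<DD> : \<ZZ>\<close> (\<open>det_scales_syzygy_into_span\<close>). If \<open>\<DD> : \<JJ>R = \<DD>\<close>, then
  \<open>\<ZZ> \<subseteq> \<DD> : \<JJ>R = \<DD>\<close>. Conversely, if \<open>\<DD> = \<ZZ>\<close> and \<open>\<JJ>R v \<subseteq> \<ZZ>\<close>, then a nonzero \<open>\<Delta> \<in> \<JJ>R\<close> can be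
  cancelled from \<open>\<Delta> v \<in> \<ZZ>\<close>, because \<open>\<ZZ>\<close> is a kernel of a map into a torsion-free module.

  The dimension theory behind these facts reduces to a single count: at most \<open>n\<close> polynomials in
  \<open>n\<close> variables are algebraically independent (\<open>alg_indep_card_le\<close>), because the \<open>N\<^sup>t\<close> monomials with
  exponents below \<open>N\<close> in \<open>t\<close> independent polynomials are linearly independent and lie in a space of
  dimension \<open>O(N\<^sup>n)\<close>.

  \<^item> Height (\<open>height_relation_ideal\<close>). For a chain \<open>C\<^sub>0 \<subset> \<dots> \<subset> C\<^sub>l = P\<close> of primes pick
    \<open>h\<^sub>i \<in> C\<^bsub>i+1\<^esub> - C\<^sub>i\<close>. Descending the chain shows that \<open>T\<^sub>j\<close>, \<open>j \<in> S\<close>, together with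
    \<open>h\<^bsub>l-1\<^esub>, \<dots>, h\<^sub>0\<close> are algebraically independent, whence \<open>|S| + l \<le> m\<close>. A chain of length \<open>g\<close> consists
    of the kernels of the maps that replace \<open>T\<^sub>j\<close> by \<open>f\<^sub>j\<close> only for \<open>j\<close> in a set growing from \<open>S\<close> to
    all indices.

  \<^item> Differentials (\<open>free_differentials_if_alg_indep\<close>). Extend \<open>f\<^sub>j\<close>, \<open>j \<in> S\<close>, by variables \<open>x\<^sub>i\<close> to a
    maximal independent family; it has at most \<open>n\<close> members. A relation of least degree between the
    family and a further \<open>x\<^sub>i\<close> has, in characteristic zero, a partial derivative that does not vanish
    at the family, so the chain rule puts a multiple of \<open>dx\<^sub>i\<close> into the span of the differentials.
    At most \<open>n\<close> vectors that span a space of dimension \<open>n\<close> are independent.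

  \<^item> Minor (\<open>nonzero_jacobian_minor\<close>). Relations of least degree between \<open>f\<^sub>j\<close>, \<open>j \<in> S\<close>, and one
    further \<open>f\<^sub>i\<close> show that the gradients of \<open>P\<close> at \<open>f\<close>, hence those of a generating set, span,
    up to nonzero multiples, the whole space modulo the coordinates in \<open>S\<close>. A basis extension
    selects \<open>g\<close> generators.
\<close>

section \<open>Free families over an integral domain\<close>

interpretation ideal: Modules.module "(*) :: 'a::comm_ring_1 \<Rightarrow> 'a \<Rightarrow> 'a"
  by unfold_locales (simp_all only: distrib_left distrib_right mult.assoc mult_1_left)

interpretation rmod: Modules.module "(*s) :: 'a::comm_ring_1 \<Rightarrow> 'a ^ 'n::finite \<Rightarrow> 'a ^ 'n"
  by unfold_locales
    (simp_all only: vector_add_ldistrib vector_sadd_rdistrib vector_smult_assoc vector_smult_lid)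

text \<open>Linear independence of a family rather than of a set, so that a repeated vector counts as a
  dependence.\<close>

definition free_family :: "('i \<Rightarrow> 'a::comm_ring_1 ^ 'n::finite) \<Rightarrow> 'i set \<Rightarrow> bool" where
  "free_family h I \<longleftrightarrow> (\<forall>c. (\<Sum>i\<in>I. c i *s h i) = 0 \<longrightarrow> (\<forall>i\<in>I. c i = 0))"

definition fract_vec :: "'a::idom ^ 'n::finite \<Rightarrow> 'a fract ^ 'n" where
  "fract_vec v = (\<chi> j. to_fract (v $ j))"

lemma fract_vec_nth [simp]: "fract_vec v $ j = to_fract (v $ j)"
  by (simp add: fract_vec_def)

lemma fract_vec_sum: "fract_vec (\<Sum>i\<in>I. c i *s h i) = (\<Sum>i\<in>I. to_fract (c i) *s fract_vec (h i))"
  by (simp add: Finite_Cartesian_Product.vec_eq_iff sum_component)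

lemma fract_vec_0 [simp]: "fract_vec v = 0 \<longleftrightarrow> v = 0"
  by (simp add: Finite_Cartesian_Product.vec_eq_iff)

lemma inj_fract_vec: "inj fract_vec"
  by (rule injI) (simp add: Finite_Cartesian_Product.vec_eq_iff)

text \<open>Clearing denominators turns linear relations over the fraction field into relations over the
  domain.\<close>

lemma common_denominator:
  fixes u :: "'i \<Rightarrow> 'a::idom fract"
  assumes "finite I"
  shows "\<exists>d c. d \<noteq> 0 \<and> (\<forall>i\<in>I. to_fract d * u i = to_fract (c i))"
  using assms
proof (induction I)
  case empty
  show ?case by (intro exI[of _ 1]) auto
next
  case (insert x I)
  obtain d c where d: "d \<noteq> 0" "\<forall>i\<in>I. to_fract d * u i = to_fract (c i)"
    using insert.IH by blast
  obtain a b where ab: "u x = Fraction_Field.Fract a b" "b \<noteq> 0"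
    by (cases "u x") auto
  have "to_fract (d * b) * u x = to_fract (d * a)"
    using ab by (simp add: Fract_conv_to_fract to_fract_mult)
  moreover have "\<forall>i\<in>I. to_fract (d * b) * u i = to_fract (b * c i)"
  proof
    fix i assume "i \<in> I"
    then have "to_fract d * u i = to_fract (c i)" using d(2) by blast
    then have "to_fract b * (to_fract d * u i) = to_fract b * to_fract (c i)" by simp
    then show "to_fract (d * b) * u i = to_fract (b * c i)"
      by (simp only: to_fract_mult mult_ac)
  qed
  ultimately have "\<forall>i\<in>insert x I. to_fract (d * b) * u i =
      to_fract ((\<lambda>i. if i = x then d * a else b * c i) i)"
    using insert.hyps(2) by (metis insert_iff)
  moreover have "d * b \<noteq> 0" using d ab by simp
  ultimately show ?case
    by (intro exI[of _ "d * b"] exI[of _ "\<lambda>i. if i = x then d * a else b * c i"] conjI)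
qed

lemma free_family_fract_vec:
  fixes h :: "'i \<Rightarrow> 'a::idom ^ 'n::finite"
  assumes fin: "finite I" and free: "free_family h I"
  shows "inj_on (fract_vec \<circ> h) I" and "vec.independent ((fract_vec \<circ> h) ` I)"
proof -
  have inj: "inj_on h I"
  proof (rule inj_onI, rule ccontr)
    fix i j assume ij: "i \<in> I" "j \<in> I" "h i = h j" "i \<noteq> j"
    define c :: "'i \<Rightarrow> 'a" where "c l = (if l = i then 1 else if l = j then -1 else 0)" for l
    have "(\<Sum>l\<in>I. c l *s h l) = (\<Sum>l\<in>{i, j}. c l *s h l)"
      by (rule sum.mono_neutral_right) (use fin ij in \<open>auto simp: c_def\<close>)
    also have "\<dots> = 0" using ij by (simp add: c_def)
    finally have "c i = 0" using free ij unfolding free_family_def by blast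
    then show False by (simp add: c_def)
  qed
  show injf: "inj_on (fract_vec \<circ> h) I"
    using inj by (rule comp_inj_on) (rule inj_on_subset[OF inj_fract_vec subset_UNIV])
  have "u (fract_vec (h i)) = 0"
    if u: "(\<Sum>v\<in>(fract_vec \<circ> h) ` I. u v *s v) = 0" and i: "i \<in> I" for u i
  proof -
    obtain d c where d: "d \<noteq> 0" and c: "\<And>i. i \<in> I \<Longrightarrow> to_fract d * u (fract_vec (h i)) = to_fract (c i)"
      using common_denominator[OF fin, of "\<lambda>i. u (fract_vec (h i))"] by blast
    have "fract_vec (\<Sum>i\<in>I. c i *s h i) = (\<Sum>i\<in>I. to_fract d *s (u (fract_vec (h i)) *s fract_vec (h i)))"
      unfolding fract_vec_sum by (rule sum.cong) (simp_all add: c vector_smult_assoc)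
    also have "\<dots> = to_fract d *s (\<Sum>v\<in>(fract_vec \<circ> h) ` I. u v *s v)"
      by (subst sum.reindex[OF injf]) (simp add: vec.scale_sum_right)
    also have "\<dots> = 0" unfolding u by simp
    finally have "(\<Sum>i\<in>I. c i *s h i) = 0" by simp
    then have "c i = 0" using free i unfolding free_family_def by blast
    then show ?thesis using c[OF i] d by simp
  qed
  then show "vec.independent ((fract_vec \<circ> h) ` I)"
    using fin by (subst vec.dependent_finite) auto
qed

lemma free_family_card_le:
  fixes h :: "'i \<Rightarrow> 'a::idom ^ 'n::finite"
  assumes "finite I" "free_family h I"
  shows "card I \<le> CARD('n)"
proof -
  note ind = free_family_fract_vec[OF assms]
  have "card I = card ((fract_vec \<circ> h) ` I)"
    using card_image[OF ind(1)] by simp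
  also have "\<dots> = vec.dim ((fract_vec \<circ> h) ` I)"
    using vec.dim_eq_card_independent[OF ind(2)] by simp
  also have "\<dots> \<le> vec.dim (UNIV :: ('a fract ^ 'n) set)"
    by (rule vec.dim_subset) simp
  also have "\<dots> = CARD('n)" by (rule vec_dim_card)
  finally show ?thesis .
qed

lemma fract_vec_span:
  assumes "v \<in> rmod.span X"
  shows "fract_vec v \<in> vec.span (fract_vec ` X)"
proof -
  obtain t r where t: "finite t" "t \<subseteq> X" "v = (\<Sum>a\<in>t. r a *s a)"
    using assms unfolding rmod.span_explicit by blast
  have "fract_vec v = (\<Sum>a\<in>t. to_fract (r a) *s fract_vec a)"
    unfolding t(3) by (rule fract_vec_sum)
  also have "\<dots> \<in> vec.span (fract_vec ` X)"
    by (intro vec.span_sum vec.span_scale vec.span_base) (use t(2) in auto)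
  finally show ?thesis .
qed

text \<open>Steinitz extension inside the fraction field. The vectors of \<open>X\<close> need to span only
  generically: a nonzero multiple of each unit vector suffices, since it becomes invertible there.\<close>

lemma free_family_extend_to_basis:
  fixes h :: "'i \<Rightarrow> 'a::idom ^ 'n::finite" and X :: "('a ^ 'n) set"
  assumes fin: "finite I" and free: "free_family h I" and hX: "h ` I \<subseteq> X"
    and gen: "\<And>j. \<exists>b. b \<noteq> 0 \<and> b *s axis j 1 \<in> rmod.span X"
  shows "\<exists>B. h ` I \<subseteq> B \<and> B \<subseteq> X \<and> finite B \<and> card B = CARD('n) \<and> free_family (\<lambda>v. v) B"
proof -
  let ?X = "fract_vec ` X"
  note ind = free_family_fract_vec[OF fin free]
  have "(fract_vec \<circ> h) ` I \<subseteq> ?X" using hX by auto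
  then obtain B' where B': "(fract_vec \<circ> h) ` I \<subseteq> B'" "B' \<subseteq> ?X" "vec.independent B'" "?X \<subseteq> vec.span B'"
    using vec.maximal_independent_subset_extend[OF _ ind(2)] by blast
  have "axis j 1 \<in> vec.span ?X" for j :: 'n
  proof -
    obtain b where b: "b \<noteq> 0" "b *s axis j 1 \<in> rmod.span X" using gen by blast
    have "fract_vec (b *s axis j 1) = to_fract b *s (axis j 1 :: 'a fract ^ 'n)"
      by (simp add: Finite_Cartesian_Product.vec_eq_iff axis_def)
    then have "to_fract b *s axis j 1 \<in> vec.span ?X"
      using fract_vec_span[OF b(2)] by simp
    then have "inverse (to_fract b) *s (to_fract b *s axis j 1) \<in> vec.span ?X"
      by (rule vec.span_scale)
    then show ?thesis using b(1) by (simp add: vector_smult_assoc)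
  qed
  then have "cart_basis \<subseteq> vec.span ?X" by (auto simp: cart_basis_def)
  then have "vec.span cart_basis \<subseteq> vec.span ?X" by (rule vec.span_minimal) simp
  then have spanX: "UNIV \<subseteq> vec.span ?X" by (simp only: vec.span_Basis)
  then have spanB: "vec.span B' = UNIV"
    using spanX vec.span_minimal[OF B'(4) vec.subspace_span] by blast
  have card: "card B' = CARD('n)"
    using vec.basis_card_eq_dim[of B' UNIV] spanB B'(3) vec_dim_card by auto
  have finB': "finite B'" using card using card_ge_0_finite[of B'] by simp
  \<comment> \<open>the basis found over the fraction field consists of images of vectors of \<open>X\<close>\<close>
  define B where "B = fract_vec -` B'"
  have img: "fract_vec ` B = B'" using B'(2) by (auto simp: B_def)
  have finB: "finite B" unfolding B_def
    by (rule finite_vimageI[OF finB' inj_fract_vec])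
  have inj: "inj_on fract_vec B" by (rule inj_on_subset[OF inj_fract_vec subset_UNIV])
  have "card B = card B'" using card_image[OF inj] img by simp
  moreover have "h ` I \<subseteq> B" using B'(1) by (auto simp: B_def)
  moreover have "B \<subseteq> X"
  proof
    fix v assume "v \<in> B"
    then have "fract_vec v \<in> fract_vec ` X" using B'(2) by (auto simp: B_def)
    then show "v \<in> X" by (simp only: inj_image_mem_iff[OF inj_fract_vec])
  qed
  moreover have "free_family (\<lambda>v. v) B"
    unfolding free_family_def
  proof (intro allI impI ballI)
    fix c v assume c: "(\<Sum>v\<in>B. c v *s v) = 0" and v: "v \<in> B"
    define u where "u w = to_fract (c (inv_into B fract_vec w))" for w
    have "(\<Sum>w\<in>B'. u w *s w) = (\<Sum>v\<in>B. to_fract (c v) *s fract_vec v)"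
      unfolding img[symmetric] by (simp add: sum.reindex[OF inj] u_def inj)
    also have "\<dots> = 0" using c by (simp add: fract_vec_sum[symmetric])
    finally have "(\<Sum>w\<in>B'. u w *s w) = 0" .
    then have "\<forall>w\<in>B'. u w = 0"
      using B'(3) unfolding vec.dependent_finite[OF finB'] by blast
    then have "u (fract_vec v) = 0" using v img by blast
    then show "c v = 0" using v inj by (simp add: u_def)
  qed
  ultimately show ?thesis using card finB by (intro exI[of _ B] conjI) simp_all
qed

lemma free_family_subset:
  assumes "free_family h J" "I \<subseteq> J" "finite J"
  shows "free_family h I"
  unfolding free_family_def
proof (intro allI impI ballI)
  fix c i
  assume c: "(\<Sum>i\<in>I. c i *s h i) = 0" and i: "i \<in> I"
  define d where "d j = (if j \<in> I then c j else 0)" for j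
  have "(\<Sum>j\<in>J. d j *s h j) = (\<Sum>j\<in>I. d j *s h j)"
    by (rule sum.mono_neutral_right) (use assms in \<open>auto simp: d_def\<close>)
  also have "\<dots> = 0" unfolding c[symmetric] by (rule sum.cong) (auto simp: d_def)
  finally have "d i = 0" using assms(1,2) i unfolding free_family_def by blast
  then show "c i = 0" using i by (simp add: d_def)
qed

lemma free_family_reindex:
  assumes inj: "inj_on \<pi> I" and free: "free_family h (\<pi> ` I)"
  shows "free_family (\<lambda>i. h (\<pi> i)) I"
  unfolding free_family_def
proof (intro allI impI ballI)
  fix c i
  assume c: "(\<Sum>i\<in>I. c i *s h (\<pi> i)) = 0" and i: "i \<in> I"
  have "(\<Sum>w\<in>\<pi> ` I. c (inv_into I \<pi> w) *s h w) = 0"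
    unfolding c[symmetric] by (subst sum.reindex[OF inj]) (auto intro!: sum.cong simp: inj)
  then have "\<forall>w\<in>\<pi> ` I. c (inv_into I \<pi> w) = 0"
    by (rule free[unfolded free_family_def, THEN spec, THEN mp])
  then have "c (inv_into I \<pi> (\<pi> i)) = 0" using i by blast
  then show "c i = 0" using inj i by simp
qed

text \<open>Families indexed by a disjoint sum are used below to join vectors of different origin; this
  splits their relations into the two parts.\<close>

lemma free_family_Plus:
  assumes "finite S" "finite T"
  shows "free_family h (S <+> T) \<longleftrightarrow>
    (\<forall>c d. (\<Sum>j\<in>S. c j *s h (Inl j)) + (\<Sum>a\<in>T. d a *s h (Inr a)) = 0 \<longrightarrow>
      (\<forall>j\<in>S. c j = 0) \<and> (\<forall>a\<in>T. d a = 0))" (is "?L \<longleftrightarrow> ?R")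
proof
  assume L: ?L
  show ?R
  proof (intro allI impI)
    fix c d
    assume "(\<Sum>j\<in>S. c j *s h (Inl j)) + (\<Sum>a\<in>T. d a *s h (Inr a)) = 0"
    then have "(\<Sum>i\<in>S <+> T. case_sum c d i *s h i) = 0"
      by (simp add: sum.Plus[OF assms])
    then have "\<forall>i\<in>S <+> T. case_sum c d i = 0"
      by (rule L[unfolded free_family_def, THEN spec, THEN mp])
    then show "(\<forall>j\<in>S. c j = 0) \<and> (\<forall>a\<in>T. d a = 0)" by (auto simp: ball_Un Plus_def)
  qed
next
  assume R: ?R
  show ?L
    unfolding free_family_def
  proof (intro allI impI)
    fix c
    assume "(\<Sum>i\<in>S <+> T. c i *s h i) = 0"
    then have "(\<Sum>j\<in>S. c (Inl j) *s h (Inl j)) + (\<Sum>a\<in>T. c (Inr a) *s h (Inr a)) = 0"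
      by (simp add: sum.Plus[OF assms])
    then have "(\<forall>j\<in>S. c (Inl j) = 0) \<and> (\<forall>a\<in>T. c (Inr a) = 0)"
      by (rule R[THEN spec, THEN spec, THEN mp])
    then show "\<forall>i\<in>S <+> T. c i = 0" by auto
  qed
qed

section \<open>Minors and free rows\<close>

text \<open>The adjugate matrix as a function \<open>B\<close> of two indices, so that Cramer's rule can be applied to
  coordinates of vectors without packing them into matrices.\<close>

lemma adjugate_entries:
  fixes M :: "nat \<Rightarrow> nat \<Rightarrow> 'a::comm_ring_1" and g :: nat
  defines "D \<equiv> Determinant.det (Matrix.mat g g (\<lambda>(a, b). M a b))"
  shows "\<exists>B. \<forall>a<g. \<forall>b<g. (\<Sum>k<g. M a k * B k b) = (if a = b then D else 0) \<and>
    (\<Sum>k<g. B a k * M k b) = (if a = b then D else 0)"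
proof -
  let ?A = "Matrix.mat g g (\<lambda>(a, b). M a b)"
  have A: "?A \<in> carrier_mat g g" by simp
  have entry: "(X * Y) $$ (a, b) = (\<Sum>k<g. X $$ (a, k) * Y $$ (k, b))"
    if "X \<in> carrier_mat g g" "Y \<in> carrier_mat g g" "a < g" "b < g" for X Y :: "'a mat" and a b
    using that by (simp add: times_mat_def scalar_prod_def lessThan_atLeast0)
  have "(\<Sum>k<g. M a k * adj_mat ?A $$ (k, b)) = (if a = b then D else 0)"
    if "a < g" "b < g" for a b
  proof -
    have "(\<Sum>k<g. M a k * adj_mat ?A $$ (k, b)) = (?A * adj_mat ?A) $$ (a, b)"
      unfolding entry[OF A adj_mat(1)[OF A] that] by (rule sum.cong) (use that in simp_all)
    also have "\<dots> = (if a = b then D else 0)"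
      unfolding adj_mat(2)[OF A] using that by (simp add: D_def)
    finally show ?thesis .
  qed
  moreover have "(\<Sum>k<g. adj_mat ?A $$ (a, k) * M k b) = (if a = b then D else 0)"
    if "a < g" "b < g" for a b
  proof -
    have "(\<Sum>k<g. adj_mat ?A $$ (a, k) * M k b) = (adj_mat ?A * ?A) $$ (a, b)"
      unfolding entry[OF adj_mat(1)[OF A] A that] by (rule sum.cong) (use that in simp_all)
    also have "\<dots> = (if a = b then D else 0)"
      unfolding adj_mat(3)[OF A] using that by (simp add: D_def)
    finally show ?thesis .
  qed
  ultimately show ?thesis by (intro exI[of _ "\<lambda>a b. adj_mat ?A $$ (a, b)"] allI impI conjI)
qed

text \<open>Multiplying a relation between the rows with the adjugate leaves \<open>d\<^sub>a det(M) = 0\<close>.\<close>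

lemma det_nonzero_rows_free:
  fixes M :: "nat \<Rightarrow> nat \<Rightarrow> 'a::idom" and g :: nat
  assumes D: "Determinant.det (Matrix.mat g g (\<lambda>(a, b). M a b)) \<noteq> 0"
    and rel: "\<And>b. b < g \<Longrightarrow> (\<Sum>a<g. d a * M a b) = 0" and a: "a < g"
  shows "d a = 0"
proof -
  let ?D = "Determinant.det (Matrix.mat g g (\<lambda>(a, b). M a b))"
  obtain B where B: "\<And>a b. a < g \<Longrightarrow> b < g \<Longrightarrow> (\<Sum>k<g. M a k * B k b) = (if a = b then ?D else 0)"
    using adjugate_entries[where M = M and g = g] by metis
  have "0 = (\<Sum>b<g. (\<Sum>i<g. d i * M i b) * B b a)"
    by (rule sum.neutral[symmetric]) (simp add: rel)
  also have "\<dots> = (\<Sum>i<g. \<Sum>b<g. d i * (M i b * B b a))"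
    unfolding sum_distrib_right by (subst sum.swap) (simp only: mult.assoc)
  also have "\<dots> = (\<Sum>i<g. if i = a then d i * ?D else 0)"
    unfolding sum_distrib_left[symmetric] by (rule sum.cong) (auto simp: B a)
  also have "\<dots> = d a * ?D" using a by simp
  finally show ?thesis using D by simp
qed

lemma rows_free_det_nonzero:
  fixes M :: "nat \<Rightarrow> nat \<Rightarrow> 'a::idom" and g :: nat
  assumes "\<And>d. (\<And>b. b < g \<Longrightarrow> (\<Sum>a<g. d a * M a b) = 0) \<Longrightarrow> \<forall>a<g. d a = 0"
  shows "Determinant.det (Matrix.mat g g (\<lambda>(a, b). M a b)) \<noteq> 0"
proof
  let ?A = "Matrix.mat g g (\<lambda>(a, b). M a b)"
  assume "Determinant.det ?A = 0"
  then have "Determinant.det (transpose_mat ?A) = 0" by (simp add: Determinant.det_transpose[of _ g])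
  then obtain v where v: "v \<in> carrier_vec g" "v \<noteq> 0\<^sub>v g" "transpose_mat ?A *\<^sub>v v = 0\<^sub>v g"
    using det_0_iff_vec_prod_zero[of "transpose_mat ?A" g] by auto
  have "(\<Sum>a<g. vec_index v a * M a b) = 0" if b: "b < g" for b
  proof -
    have "vec_index (transpose_mat ?A *\<^sub>v v) b = (\<Sum>a<g. M a b * vec_index v a)"
      using b v(1) by (simp add: scalar_prod_def lessThan_atLeast0)
    then show ?thesis using b by (simp add: v(3) mult.commute)
  qed
  then have "\<forall>a<g. vec_index v a = 0" by (rule assms)
  then have "v = 0\<^sub>v g" using v(1) by (intro eq_vecI) auto
  then show False using v(2) by contradiction
qed

section \<open>Evaluation of polynomials\<close>

definition mon_eval :: "('v \<Rightarrow> 'b::comm_ring_1) \<Rightarrow> ('v \<Rightarrow>\<^sub>0 nat) \<Rightarrow> 'b" where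
  "mon_eval g t = (\<Prod>v\<in>Poly_Mapping.keys t. g v ^ Poly_Mapping.lookup t v)"

text \<open>Evaluation along a map \<open>\<phi>\<close> of the coefficients. The choice \<open>\<phi> = Const\<close> below is substitution of
  polynomials with the same coefficients; \<open>\<phi> = Const \<circ> Const\<close> gives substitutions into a polynomial
  ring whose coefficients are themselves polynomials. The variables may form an
  infinite type, as the index types of families do below, so a monomial is a product over its keys.\<close>

definition peval ::
    "('k::comm_ring_1 \<Rightarrow> 'b::comm_ring_1) \<Rightarrow> ('v \<Rightarrow> 'b) \<Rightarrow> (('v \<Rightarrow>\<^sub>0 nat) \<Rightarrow>\<^sub>0 'k) \<Rightarrow> 'b" where
  "peval \<phi> g F = (\<Sum>t\<in>Poly_Mapping.keys F. \<phi> (Poly_Mapping.lookup F t) * mon_eval g t)"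

abbreviation Const :: "'k \<Rightarrow> ('v \<Rightarrow>\<^sub>0 nat) \<Rightarrow>\<^sub>0 'k::comm_ring_1" where
  "Const \<equiv> Poly_Mapping.single 0"

definition Var :: "'v \<Rightarrow> ('v \<Rightarrow>\<^sub>0 nat) \<Rightarrow>\<^sub>0 'k::comm_ring_1" where
  "Var v = Poly_Mapping.single (Poly_Mapping.single v 1) 1"

lemma mon_superset:
  assumes "finite A" "Poly_Mapping.keys t \<subseteq> A"
  shows "mon_eval g t = (\<Prod>v\<in>A. g v ^ Poly_Mapping.lookup t v)"
  unfolding mon_eval_def
  by (rule prod.mono_neutral_left) (use assms in \<open>auto simp: in_keys_iff\<close>)

lemma mon_0 [simp]: "mon_eval g 0 = 1"
  by (simp add: mon_eval_def)

lemma mon_single [simp]: "mon_eval g (Poly_Mapping.single v n) = g v ^ n"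
  by (subst mon_superset[of "{v}"]) auto

lemma mon_add: "mon_eval g (t + s) = mon_eval g t * mon_eval g s"
proof -
  let ?A = "Poly_Mapping.keys t \<union> Poly_Mapping.keys s"
  have "Poly_Mapping.keys (t + s) \<subseteq> ?A" by (rule Poly_Mapping.keys_add)
  then show ?thesis
    by (simp add: mon_superset[of ?A] lookup_add power_add prod.distrib)
qed

lemma expand_singles: "F = (\<Sum>t\<in>Poly_Mapping.keys F. Poly_Mapping.single t (Poly_Mapping.lookup F t))"
  by (rule poly_mapping_eqI) (auto simp: lookup_sum lookup_single when_def in_keys_iff sum.delta)

lemma comm_ring_hom_Const: "comm_ring_hom (Const :: 'k::comm_ring_1 \<Rightarrow> ('v \<Rightarrow>\<^sub>0 nat) \<Rightarrow>\<^sub>0 'k)"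
  by unfold_locales (simp_all add: single_add mult_single)

context
  fixes \<phi> :: "'k::comm_ring_1 \<Rightarrow> 'b::comm_ring_1" and g :: "'v \<Rightarrow> 'b"
  assumes hom: "comm_ring_hom \<phi>"
begin

interpretation \<phi>: comm_ring_hom \<phi> by (rule hom)

lemma peval_superset:
  assumes "finite A" "Poly_Mapping.keys F \<subseteq> A"
  shows "peval \<phi> g F = (\<Sum>t\<in>A. \<phi> (Poly_Mapping.lookup F t) * mon_eval g t)"
  unfolding peval_def
  by (rule sum.mono_neutral_left) (use assms in \<open>auto simp: in_keys_iff\<close>)

lemma peval_0: "peval \<phi> g 0 = 0"
  by (simp add: peval_def)

lemma peval_single: "peval \<phi> g (Poly_Mapping.single t c) = \<phi> c * mon_eval g t"
  by (subst peval_superset[of "{t}"]) auto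

lemma peval_Const: "peval \<phi> g (Const c) = \<phi> c"
  by (simp add: peval_single)

lemma peval_Var: "peval \<phi> g (Var v) = g v"
  by (simp add: peval_single Var_def)

lemma peval_add: "peval \<phi> g (F + G) = peval \<phi> g F + peval \<phi> g G"
proof -
  let ?A = "Poly_Mapping.keys F \<union> Poly_Mapping.keys G"
  have "Poly_Mapping.keys (F + G) \<subseteq> ?A" by (rule Poly_Mapping.keys_add)
  then show ?thesis
    by (simp add: peval_superset[of ?A] lookup_add \<phi>.hom_add sum.distrib distrib_right)
qed

lemma peval_sum: "peval \<phi> g (\<Sum>i\<in>I. F i) = (\<Sum>i\<in>I. peval \<phi> g (F i))"
  by (induction I rule: infinite_finite_induct) (simp_all add: peval_0 peval_add)

lemma peval_mult: "peval \<phi> g (F * G) = peval \<phi> g F * peval \<phi> g G"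
proof -
  have "F * G = (\<Sum>t\<in>Poly_Mapping.keys F. \<Sum>s\<in>Poly_Mapping.keys G.
      Poly_Mapping.single (t + s) (Poly_Mapping.lookup F t * Poly_Mapping.lookup G s))"
    by (subst expand_singles[of F], subst expand_singles[of G]) (simp only: sum_product mult_single)
  then have "peval \<phi> g (F * G) = (\<Sum>t\<in>Poly_Mapping.keys F. \<Sum>s\<in>Poly_Mapping.keys G.
      (\<phi> (Poly_Mapping.lookup F t) * mon_eval g t) * (\<phi> (Poly_Mapping.lookup G s) * mon_eval g s))"
    by (simp only: peval_sum peval_single \<phi>.hom_mult mon_add mult_ac)
  also have "\<dots> = peval \<phi> g F * peval \<phi> g G"
    by (simp only: peval_def sum_product)
  finally show ?thesis .
qed

lemma comm_ring_hom_peval: "comm_ring_hom (peval \<phi> g)"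
proof -
  have "peval \<phi> g 1 = 1" using peval_Const[of 1] by simp
  moreover have "peval \<phi> g (- F) = - peval \<phi> g F" for F
  proof -
    have "peval \<phi> g (- F) + peval \<phi> g F = peval \<phi> g (- F + F)" by (simp only: peval_add)
    also have "\<dots> = 0" by (simp add: peval_0)
    finally show ?thesis by (simp add: eq_neg_iff_add_eq_0)
  qed
  ultimately show ?thesis
    by unfold_locales (simp_all add: peval_0 peval_add peval_mult)
qed

end

text \<open>With \<open>\<psi>\<close> itself an evaluation, this composes substitutions.\<close>

lemma hom_peval:
  assumes "comm_ring_hom \<psi>"
  shows "\<psi> (peval \<phi> g F) = peval (\<lambda>c. \<psi> (\<phi> c)) (\<lambda>v. \<psi> (g v)) F"
proof -
  interpret comm_ring_hom \<psi> by fact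
  show ?thesis by (simp add: peval_def mon_eval_def hom_sum hom_mult hom_prod hom_power)
qed

lemma Var_power: "(Var v :: ('v \<Rightarrow>\<^sub>0 nat) \<Rightarrow>\<^sub>0 'k::comm_ring_1) ^ n = Poly_Mapping.single (Poly_Mapping.single v n) 1"
  by (induction n) (simp_all add: Var_def mult_single single_add[symmetric])

lemma mon_Var: "(mon_eval Var t :: ('v \<Rightarrow>\<^sub>0 nat) \<Rightarrow>\<^sub>0 'k::comm_ring_1) = Poly_Mapping.single t 1"
proof -
  have "(\<Prod>v\<in>A. (Var v :: ('v \<Rightarrow>\<^sub>0 nat) \<Rightarrow>\<^sub>0 'k) ^ n v) =
      Poly_Mapping.single (\<Sum>v\<in>A. Poly_Mapping.single v (n v)) 1" for A n
    by (induction A rule: infinite_finite_induct) (simp_all add: Var_power mult_single)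
  then show ?thesis unfolding mon_eval_def using expand_singles[of t] by simp
qed

lemma peval_id: "peval Const Var F = F"
  by (subst (2) expand_singles) (simp add: peval_def mon_Var mult_single)

text \<open>Statements that are stable under sums and products, such as the chain rule below, need to be
  checked only on constants and variables.\<close>

lemma mpoly_induct [case_names Const Var add mult]:
  assumes C: "\<And>c. P (Const c)" and V: "\<And>v. P (Var v)"
    and A: "\<And>F G. P F \<Longrightarrow> P G \<Longrightarrow> P (F + G)" and M: "\<And>F G. P F \<Longrightarrow> P G \<Longrightarrow> P (F * G)"
  shows "P (F :: ('v \<Rightarrow>\<^sub>0 nat) \<Rightarrow>\<^sub>0 'k::comm_ring_1)"
proof -
  have one: "P 1" using C[of 1] by simp
  have zero: "P 0" using C[of 0] by simp
  have pow: "P (Var v ^ n)" for v n by (induction n) (auto intro: one M V)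
  have mons: "P (\<Prod>v\<in>A. Var v ^ n v)" for A and n :: "'v \<Rightarrow> nat"
    by (induction A rule: infinite_finite_induct) (auto intro: one M pow)
  have sum: "P (\<Sum>t\<in>A. Q t)" if "\<And>t. P (Q t)" for A and Q :: "('v \<Rightarrow>\<^sub>0 nat) \<Rightarrow> _"
    by (induction A rule: infinite_finite_induct) (auto intro: zero A that)
  have "P (peval Const Var F)"
    unfolding peval_def mon_eval_def by (intro sum M C mons)
  then show ?thesis by (simp only: peval_id)
qed

section \<open>Polynomials in a subset of the variables\<close>

definition polys_in :: "'v set \<Rightarrow> (('v \<Rightarrow>\<^sub>0 nat) \<Rightarrow>\<^sub>0 'k::comm_ring_1) set" where
  "polys_in I = {F. \<forall>t\<in>Poly_Mapping.keys F. Poly_Mapping.keys t \<subseteq> I}"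

lemma polys_in_mono: "I \<subseteq> J \<Longrightarrow> polys_in I \<subseteq> polys_in J"
  by (auto simp: polys_in_def)

lemma polys_in_0 [simp]: "0 \<in> polys_in I" by (simp add: polys_in_def)

lemma polys_in_single: "Poly_Mapping.keys t \<subseteq> I \<Longrightarrow> Poly_Mapping.single t c \<in> polys_in I"
  by (simp add: polys_in_def)

lemma polys_in_Const [simp]: "Const c \<in> polys_in I" by (simp add: polys_in_single)

lemma polys_in_1 [simp]: "1 \<in> polys_in I" by (simp add: polys_in_def)

lemma polys_in_Var: "v \<in> I \<Longrightarrow> Var v \<in> polys_in I" by (simp add: Var_def polys_in_single)

lemma polys_in_add: "F \<in> polys_in I \<Longrightarrow> G \<in> polys_in I \<Longrightarrow> F + G \<in> polys_in I"
  using Poly_Mapping.keys_add[of F G] unfolding polys_in_def by blast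

lemma polys_in_mult: "F \<in> polys_in I \<Longrightarrow> G \<in> polys_in I \<Longrightarrow> F * G \<in> polys_in I"
  unfolding polys_in_def
proof safe
  fix t v
  assume F: "\<forall>t\<in>Poly_Mapping.keys F. Poly_Mapping.keys t \<subseteq> I"
    and G: "\<forall>t\<in>Poly_Mapping.keys G. Poly_Mapping.keys t \<subseteq> I"
    and t: "t \<in> Poly_Mapping.keys (F * G)" and v: "v \<in> Poly_Mapping.keys t"
  obtain a b where ab: "a \<in> Poly_Mapping.keys F" "b \<in> Poly_Mapping.keys G" "t = a + b"
    using t Poly_Mapping.keys_mult[of F G] by blast
  have "v \<in> Poly_Mapping.keys a \<union> Poly_Mapping.keys b"
    using v Poly_Mapping.keys_add[of a b] ab(3) by blast
  then show "v \<in> I" using F G ab by blast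
qed

lemma polys_in_sum: "(\<And>i. i \<in> A \<Longrightarrow> F i \<in> polys_in I) \<Longrightarrow> (\<Sum>i\<in>A. F i) \<in> polys_in I"
  by (induction A rule: infinite_finite_induct) (simp_all add: polys_in_add)

lemma polys_in_prod: "(\<And>i. i \<in> A \<Longrightarrow> F i \<in> polys_in I) \<Longrightarrow> (\<Prod>i\<in>A. F i) \<in> polys_in I"
  by (induction A rule: infinite_finite_induct) (simp_all add: polys_in_mult)

lemma polys_in_power: "F \<in> polys_in I \<Longrightarrow> F ^ n \<in> polys_in I"
  by (induction n) (simp_all add: polys_in_mult)

lemma peval_polys_in:
  assumes "F \<in> polys_in J" "\<And>v. v \<in> J \<Longrightarrow> g v \<in> polys_in I"
  shows "peval Const g F \<in> polys_in I"
proof -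
  have "v \<in> J" if "t \<in> Poly_Mapping.keys F" "v \<in> Poly_Mapping.keys t" for t v
    using assms(1) that unfolding polys_in_def by blast
  then show ?thesis
    unfolding peval_def mon_eval_def
    by (intro polys_in_sum polys_in_mult polys_in_Const polys_in_prod polys_in_power assms(2))
qed

lemma peval_cong:
  assumes "F \<in> polys_in I" "\<And>v. v \<in> I \<Longrightarrow> g v = g' v"
  shows "peval \<phi> g F = peval \<phi> g' F"
  unfolding peval_def mon_eval_def
  by (intro sum.cong refl arg_cong2[where f = "(*)"] prod.cong arg_cong2[where f = "(^)"])
    (use assms in \<open>auto simp: polys_in_def\<close>)

text \<open>The coefficient of the \<open>i\<close>-th power of the variable \<open>v\<close>, as a polynomial in the other variables.\<close>

definition slice :: "'v \<Rightarrow> nat \<Rightarrow> (('v \<Rightarrow>\<^sub>0 nat) \<Rightarrow>\<^sub>0 'k::comm_ring_1) \<Rightarrow> ('v \<Rightarrow>\<^sub>0 nat) \<Rightarrow>\<^sub>0 'k" where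
  "slice v i F = (\<Sum>t\<in>{t\<in>Poly_Mapping.keys F. Poly_Mapping.lookup t v = i}.
     Poly_Mapping.single (t - Poly_Mapping.single v i) (Poly_Mapping.lookup F t))"

lemma slice_times_power:
  "slice v i F * Var v ^ i =
    (\<Sum>t\<in>{t\<in>Poly_Mapping.keys F. Poly_Mapping.lookup t v = i}. Poly_Mapping.single t (Poly_Mapping.lookup F t))"
proof -
  have "t - Poly_Mapping.single v i + Poly_Mapping.single v i = t"
    if "Poly_Mapping.lookup t v = i" for t :: "'a \<Rightarrow>\<^sub>0 nat"
    using that by (intro poly_mapping_eqI) (auto simp: lookup_add lookup_minus lookup_single when_def)
  then show ?thesis
    unfolding slice_def Var_power sum_distrib_right mult_single by (intro sum.cong) auto
qed

lemma slice_expansion: "\<exists>N. F = (\<Sum>i\<le>N. slice v i F * Var v ^ i)"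
proof -
  define N where "N = Max (insert 0 ((\<lambda>t. Poly_Mapping.lookup t v) ` Poly_Mapping.keys F))"
  have N: "Poly_Mapping.lookup t v \<le> N" if "t \<in> Poly_Mapping.keys F" for t
    unfolding N_def using that by (intro Max_ge) auto
  have "(\<Sum>i\<le>N. slice v i F * Var v ^ i) =
      (\<Sum>t\<in>Poly_Mapping.keys F. Poly_Mapping.single t (Poly_Mapping.lookup F t))"
    unfolding slice_times_power
    by (rule sum.group) (use N in auto)
  then show ?thesis using expand_singles[of F] by metis
qed

lemma slice_polys_in:
  assumes "F \<in> polys_in (insert v I)"
  shows "slice v i F \<in> polys_in I"
  unfolding slice_def
proof (intro polys_in_sum polys_in_single subsetI)
  fix t w
  assume t: "t \<in> {t \<in> Poly_Mapping.keys F. Poly_Mapping.lookup t v = i}"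
    and w: "w \<in> Poly_Mapping.keys (t - Poly_Mapping.single v i)"
  have "w \<noteq> v" using w t by (auto simp: in_keys_iff lookup_minus)
  moreover have "w \<in> Poly_Mapping.keys t" using w by (auto simp: in_keys_iff lookup_minus)
  ultimately show "w \<in> I" using assms t by (auto simp: polys_in_def)
qed

section \<open>Algebraic independence modulo an ideal\<close>

text \<open>Independence of the residue classes of \<open>g v\<close>, \<open>v \<in> I\<close>, modulo \<open>Q\<close>; for \<open>Q = {0}\<close> it is the usual
  algebraic independence over the constants.\<close>

definition alg_indep ::
    "(('w \<Rightarrow>\<^sub>0 nat) \<Rightarrow>\<^sub>0 'k::comm_ring_1) set \<Rightarrow> ('v \<Rightarrow> ('w \<Rightarrow>\<^sub>0 nat) \<Rightarrow>\<^sub>0 'k) \<Rightarrow> 'v set \<Rightarrow> bool" where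
  "alg_indep Q g I \<longleftrightarrow> (\<forall>F\<in>polys_in I. peval Const g F \<in> Q \<longrightarrow> F = 0)"

lemma peval_peval:
  "peval Const g (peval Const h F) = peval Const (\<lambda>v. peval Const g (h v)) F"
  using hom_peval[OF comm_ring_hom_peval[OF comm_ring_hom_Const, of g], of Const h F]
  by (simp add: peval_Const[OF comm_ring_hom_Const])

lemma alg_indep_empty: "alg_indep {0} g {}"
  unfolding alg_indep_def
proof (intro ballI impI)
  fix F
  assume F: "F \<in> polys_in {}" and z: "peval Const g F \<in> {0}"
  have "Poly_Mapping.keys F \<subseteq> {0}" using F by (auto simp: polys_in_def)
  then have "F = Const (Poly_Mapping.lookup F 0)"
    by (intro poly_mapping_eqI) (auto simp: lookup_single when_def in_keys_iff subset_iff)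
  then obtain c where c: "F = Const c" by blast
  have "Poly_Mapping.lookup (peval Const g F) 0 = c"
    unfolding c peval_Const[OF comm_ring_hom_Const] by simp
  then have "c = 0" using z by simp
  then show "F = 0" using c by simp
qed

lemma alg_indep_reindex:
  assumes ind: "alg_indep Q g I" and inj: "inj_on \<pi> I"
    and g': "\<And>v. v \<in> I \<Longrightarrow> g' (\<pi> v) = g v"
  shows "alg_indep Q g' (\<pi> ` I)"
  unfolding alg_indep_def
proof (intro ballI impI)
  fix F
  assume F: "F \<in> polys_in (\<pi> ` I)" and Q: "peval Const g' F \<in> Q"
  \<comment> \<open>\<open>F\<close> with its variables renamed back along \<open>\<pi>\<close>\<close>
  define F' where "F' = peval Const (\<lambda>w. Var (inv_into I \<pi> w)) F"
  have inv: "inv_into I \<pi> w \<in> I" "\<pi> (inv_into I \<pi> w) = w" if "w \<in> \<pi> ` I" for w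
    using that by (auto intro: inv_into_into f_inv_into_f)
  have "F' \<in> polys_in I"
    unfolding F'_def by (rule peval_polys_in[OF F]) (rule polys_in_Var[OF inv(1)])
  moreover have "peval Const g F' = peval Const g' F"
    unfolding F'_def peval_peval
    by (rule peval_cong[OF F])
      (metis g' inv peval_Var[OF comm_ring_hom_Const])
  ultimately have "F' = 0" using ind Q unfolding alg_indep_def by metis
  have "peval Const (\<lambda>v. Var (\<pi> v)) F' = peval Const Var F"
    unfolding F'_def peval_peval
    by (rule peval_cong[OF F]) (simp only: peval_Var[OF comm_ring_hom_Const] inv)
  then show "F = 0"
    by (simp add: peval_id \<open>F' = 0\<close> peval_0[OF comm_ring_hom_Const])
qed

lemma prime_ideal_subspace: "prime_ideal Q \<Longrightarrow> ideal.subspace Q"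
  by (simp add: prime_ideal_def)

lemma prime_ideal_mult: "prime_ideal Q \<Longrightarrow> a * b \<in> Q \<Longrightarrow> a \<in> Q \<or> b \<in> Q"
  by (auto simp: prime_ideal_def)

lemma prime_ideal_one: "prime_ideal Q \<Longrightarrow> (1::'a::comm_ring_1) \<notin> Q"
proof
  assume Q: "prime_ideal Q" and 1: "(1::'a) \<in> Q"
  have "a \<in> Q" for a
    using ideal.subspace_scale[OF prime_ideal_subspace[OF Q] 1, of a] by simp
  then show False using Q by (auto simp: prime_ideal_def)
qed

lemma prime_ideal_power: "prime_ideal Q \<Longrightarrow> h ^ n \<in> Q \<Longrightarrow> h \<in> Q"
proof (induction n)
  case 0
  then show ?case using prime_ideal_one by auto
next
  case (Suc n)
  then show ?case using prime_ideal_mult[of Q h "h ^ n"] by auto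
qed

text \<open>Going down from \<open>Q'\<close> to a smaller prime \<open>Q\<close> gains one independent element. In a relation modulo \<open>Q\<close>,
  the largest power of the new variable dividing it can be cancelled because \<open>g v \<notin> Q\<close>. As \<open>g v \<in> Q'\<close>, the lowest coefficient
  is then a relation modulo \<open>Q'\<close> between the old elements.\<close>

lemma alg_indep_insert_prime:
  assumes Q: "prime_ideal Q" and Q': "ideal.subspace Q'" and QQ': "Q \<subseteq> Q'"
    and h: "g v \<in> Q'" "g v \<notin> Q" and ind: "alg_indep Q' g I"
  shows "alg_indep Q g (insert v I)"
  unfolding alg_indep_def
proof (intro ballI impI, rule ccontr)
  interpret ev: comm_ring_hom "peval Const g"
    by (rule comm_ring_hom_peval[OF comm_ring_hom_Const])
  fix F
  assume F: "F \<in> polys_in (insert v I)" and FQ: "peval Const g F \<in> Q" and nz: "F \<noteq> 0"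
  obtain N where N: "F = (\<Sum>i\<le>N. slice v i F * Var v ^ i)" using slice_expansion[of F v] by (rule exE)
  let ?G = "\<lambda>i. peval Const g (slice v i F)"
  have "\<exists>i. slice v i F \<noteq> 0"
  proof (rule ccontr)
    assume "\<not> ?thesis"
    then have "F = 0" by (subst N) simp
    then show False using nz by simp
  qed
  \<comment> \<open>\<open>F\<close> is divisible by the power \<open>e\<close> of the variable \<open>v\<close>, and \<open>?T\<close> is the value of the quotient\<close>
  define e where "e = (LEAST i. slice v i F \<noteq> 0)"
  have e: "slice v e F \<noteq> 0" unfolding e_def by (rule LeastI_ex) fact
  have less: "slice v i F = 0" if "i < e" for i
    using not_less_Least[of i "\<lambda>i. slice v i F \<noteq> 0"] that unfolding e_def by blast
  let ?T = "\<Sum>i\<in>{e..N}. ?G i * g v ^ (i - e)"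
  have "peval Const g F = (\<Sum>i\<le>N. ?G i * g v ^ i)"
    by (subst N) (simp add: ev.hom_sum ev.hom_mult ev.hom_power peval_Var[OF comm_ring_hom_Const])
  also have "\<dots> = (\<Sum>i\<in>{e..N}. ?G i * g v ^ i)"
  proof (rule sum.mono_neutral_right)
    show "\<forall>i\<in>{..N} - {e..N}. ?G i * g v ^ i = 0"
      by (auto simp: less)
  qed auto
  also have "\<dots> = (\<Sum>i\<in>{e..N}. g v ^ e * (?G i * g v ^ (i - e)))"
  proof (rule sum.cong[OF refl])
    fix i assume "i \<in> {e..N}"
    then have "g v ^ i = g v ^ e * g v ^ (i - e)" by (simp add: power_add[symmetric])
    then show "?G i * g v ^ i = g v ^ e * (?G i * g v ^ (i - e))" by (simp only: mult_ac)
  qed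
  also have "\<dots> = g v ^ e * ?T" by (simp only: sum_distrib_left)
  finally have "g v ^ e \<in> Q \<or> ?T \<in> Q"
    using FQ prime_ideal_mult[OF Q] by simp
  then have T: "?T \<in> Q'" using prime_ideal_power[OF Q] h QQ' by blast
  have "e \<le> N"
  proof (rule ccontr)
    assume "\<not> e \<le> N"
    then have "F = 0" by (subst N) (simp add: less)
    then show False using nz by simp
  qed
  then have "{e..N} = insert e {Suc e..N}" by auto
  then have T_split: "?T = ?G e + (\<Sum>i\<in>{Suc e..N}. ?G i * g v ^ (i - e))" by simp
  have rest: "(\<Sum>i\<in>{Suc e..N}. ?G i * g v ^ (i - e)) \<in> Q'"
  proof (rule ideal.subspace_sum[OF Q'])
    fix i assume "i \<in> {Suc e..N}"
    then have "g v ^ (i - e) = g v ^ (i - Suc e) * g v"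
      by (metis Suc_diff_le atLeastAtMost_iff diff_Suc_Suc power_Suc2)
    then have "?G i * g v ^ (i - e) = (?G i * g v ^ (i - Suc e)) * g v" by (simp only: mult.assoc)
    then show "?G i * g v ^ (i - e) \<in> Q'" using ideal.subspace_scale[OF Q' h(1)] by simp
  qed
  have "?G e \<in> Q'"
    using ideal.subspace_diff[OF Q' T rest] unfolding T_split by (simp only: add_diff_cancel_right')
  then have "slice v e F = 0"
    using ind slice_polys_in[OF F] unfolding alg_indep_def by blast
  then show False using e by contradiction
qed

section \<open>The number of algebraically independent polynomials\<close>

definition exps_le :: "nat \<Rightarrow> (('w \<Rightarrow>\<^sub>0 nat) \<Rightarrow>\<^sub>0 'k::comm_ring_1) set" where
  "exps_le D = {p. \<forall>t\<in>Poly_Mapping.keys p. \<forall>v. Poly_Mapping.lookup t v \<le> D}"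

lemma exps_le_1: "1 \<in> exps_le D" by (simp add: exps_le_def)

lemma exps_le_mult: "p \<in> exps_le D \<Longrightarrow> q \<in> exps_le E \<Longrightarrow> p * q \<in> exps_le (D + E)"
  unfolding exps_le_def
proof safe
  fix t v
  assume p: "\<forall>t\<in>Poly_Mapping.keys p. \<forall>v. Poly_Mapping.lookup t v \<le> D"
    and q: "\<forall>t\<in>Poly_Mapping.keys q. \<forall>v. Poly_Mapping.lookup t v \<le> E"
    and t: "t \<in> Poly_Mapping.keys (p * q)"
  obtain a b where "a \<in> Poly_Mapping.keys p" "b \<in> Poly_Mapping.keys q" "t = a + b"
    using t Poly_Mapping.keys_mult[of p q] by blast
  then show "Poly_Mapping.lookup t v \<le> D + E" using p q by (simp add: lookup_add add_mono)
qed

lemma exps_le_power: "p \<in> exps_le D \<Longrightarrow> p ^ n \<in> exps_le (n * D)"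
  by (induction n) (simp_all add: exps_le_1 exps_le_mult)

lemma exps_le_prod:
  "(\<And>i. i \<in> A \<Longrightarrow> p i \<in> exps_le D) \<Longrightarrow> (\<Prod>i\<in>A. p i) \<in> exps_le (card A * D)"
  by (induction A rule: infinite_finite_induct) (simp_all add: exps_le_1 exps_le_mult)

lemma exps_le_mono: "p \<in> exps_le D \<Longrightarrow> D \<le> E \<Longrightarrow> p \<in> exps_le E"
  unfolding exps_le_def using order_trans by blast

lemma exps_le_exists: "\<exists>D. p \<in> exps_le D"
proof -
  let ?A = "\<Union>t\<in>Poly_Mapping.keys p. Poly_Mapping.range t"
  have "Poly_Mapping.lookup t v \<le> Max (insert 0 ?A)" if "t \<in> Poly_Mapping.keys p" for t v
  proof (cases "Poly_Mapping.lookup t v = 0")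
    case False
    then have "Poly_Mapping.lookup t v \<in> ?A"
      using that by (auto simp: in_keys_iff intro!: bexI[of _ t] in_keys_lookup_in_range)
    then show ?thesis by (intro Max_ge) auto
  qed simp
  then show ?thesis unfolding exps_le_def by blast
qed

lemma mpoly_vector_space:
  "vector_space (\<lambda>(c::'k::field) (p :: ('w \<Rightarrow>\<^sub>0 nat) \<Rightarrow>\<^sub>0 'k). Const c * p)"
  by unfold_locales (simp_all add: single_add distrib_left distrib_right mult_single mult.assoc[symmetric])

lemma sum_singles_lookup:
  "finite I \<Longrightarrow> Poly_Mapping.lookup (\<Sum>v\<in>I. Poly_Mapping.single v (a v)) w = (if w \<in> I then a w else (0::nat))"
  by (simp add: lookup_sum lookup_single when_def sum.delta)

text \<open>The \<open>N ^ card I\<close> monomials in the \<open>g v\<close> with exponents below \<open>N\<close> are linearly independent, and their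
  own exponents are at most \<open>card I * N * D\<close>. The bound counts the monomials in the ambient ring with
  such exponents.\<close>

lemma alg_indep_count:
  fixes g :: "'v \<Rightarrow> ('w::finite \<Rightarrow>\<^sub>0 nat) \<Rightarrow>\<^sub>0 'k::field"
  assumes fin: "finite I" and ind: "alg_indep {0} g I" and D: "\<And>v. v \<in> I \<Longrightarrow> g v \<in> exps_le D"
  shows "N ^ card I \<le> (card I * (N * D) + 1) ^ CARD('w)"
proof -
  interpret V: vector_space "\<lambda>(c::'k) (p :: ('w \<Rightarrow>\<^sub>0 nat) \<Rightarrow>\<^sub>0 'k). Const c * p"
    by (rule mpoly_vector_space)
  define A where "A = (I \<rightarrow>\<^sub>E {..<N})"
  define M where "M = card I * (N * D)"
  define ex where "ex a = (\<Sum>v\<in>I. Poly_Mapping.single v (a v))" for a :: "'v \<Rightarrow> nat"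
  define w where "w a = (\<Prod>v\<in>I. g v ^ a v)" for a
  have finA: "finite A" unfolding A_def by (intro finite_PiE fin) simp
  have cardA: "card A = N ^ card I" unfolding A_def using fin by (simp add: card_PiE)
  have ex_inj: "inj_on ex A"
  proof (rule inj_onI)
    fix a b assume ab: "a \<in> A" "b \<in> A" "ex a = ex b"
    have "a v = b v" if "v \<in> I" for v
      using arg_cong[OF ab(3), of "\<lambda>t. Poly_Mapping.lookup t v"] that fin
      by (simp add: ex_def sum_singles_lookup)
    then show "a = b" using ab(1,2) unfolding A_def by (intro PiE_ext) auto
  qed
  have mon_ex: "mon_eval g (ex a) = w a" for a
    by (subst mon_superset[OF fin]) (auto simp: ex_def w_def sum_singles_lookup fin in_keys_iff split: if_splits)
  have free: "c a = 0" if c: "(\<Sum>a\<in>A. Const (c a) * w a) = 0" and a: "a \<in> A" for c a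
  proof -
    \<comment> \<open>a linear relation between the monomials is the value of a polynomial relation\<close>
    define F where "F = (\<Sum>a\<in>A. Poly_Mapping.single (ex a) (c a))"
    have "F \<in> polys_in I"
      unfolding F_def by (intro polys_in_sum polys_in_single)
        (auto simp: ex_def in_keys_iff sum_singles_lookup fin split: if_splits)
    moreover have "peval Const g F = 0"
      unfolding F_def peval_sum[OF comm_ring_hom_Const] peval_single[OF comm_ring_hom_Const] mon_ex
      by (rule c)
    ultimately have "F = 0" using ind unfolding alg_indep_def by blast
    have "Poly_Mapping.lookup F (ex a) = (\<Sum>b\<in>A. if b = a then c b else 0)"
      unfolding F_def lookup_sum
      by (rule sum.cong) (use a ex_inj in \<open>auto simp: lookup_single when_def inj_on_eq_iff\<close>)
    also have "\<dots> = c a" using finA a by simp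
    finally show ?thesis using \<open>F = 0\<close> by simp
  qed
  have w_inj: "inj_on w A"
  proof (rule inj_onI, rule ccontr)
    fix a b assume ab: "a \<in> A" "b \<in> A" "w a = w b" "a \<noteq> b"
    define c :: "('v \<Rightarrow> nat) \<Rightarrow> 'k" where "c l = (if l = a then 1 else if l = b then -1 else 0)" for l
    have "(\<Sum>l\<in>A. Const (c l) * w l) = (\<Sum>l\<in>{a, b}. Const (c l) * w l)"
      by (rule sum.mono_neutral_right) (use finA ab in \<open>auto simp: c_def\<close>)
    also have "\<dots> = 0" using ab by (simp add: c_def single_uminus)
    finally have "c a = 0" using free ab(1) by blast
    then show False by (simp add: c_def)
  qed
  have indep: "V.independent (w ` A)"
    unfolding V.dependent_finite[OF finite_imageI[OF finA]]
  proof
    assume "\<exists>u. (\<exists>p\<in>w ` A. u p \<noteq> 0) \<and> (\<Sum>p\<in>w ` A. Const (u p) * p) = 0"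
    then obtain u a where a: "a \<in> A" "u (w a) \<noteq> 0" and s: "(\<Sum>p\<in>w ` A. Const (u p) * p) = 0" by blast
    have "(\<Sum>a\<in>A. Const (u (w a)) * w a) = 0" using s by (simp add: sum.reindex[OF w_inj])
    then show False using free[of "\<lambda>a. u (w a)"] a by blast
  qed
  \<comment> \<open>\<open>?E\<close> collects the exponent vectors of monomials that can occur in the products \<open>w a\<close>\<close>
  let ?E = "{s :: 'w \<Rightarrow>\<^sub>0 nat. \<forall>v. Poly_Mapping.lookup s v \<le> M}"
  let ?B = "(\<lambda>s. Poly_Mapping.single s (1::'k)) ` ?E"
  have subE: "Poly_Mapping.lookup ` ?E \<subseteq> (UNIV \<rightarrow>\<^sub>E {..M})" by auto
  have injE: "inj_on Poly_Mapping.lookup ?E" by (rule inj_onI) (rule poly_mapping_eqI, simp)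
  have finP: "finite ((UNIV :: 'w set) \<rightarrow>\<^sub>E {..M})" by (intro finite_PiE) auto
  have finE: "finite ?E" using finite_subset[OF subE finP] injE by (rule finite_imageD)
  have "card ?E \<le> card ((UNIV :: 'w set) \<rightarrow>\<^sub>E {..M})"
    by (rule card_inj_on_le[OF injE subE finP])
  also have "\<dots> = (M + 1) ^ CARD('w)" by (simp add: card_PiE)
  finally have cardE: "card ?E \<le> (M + 1) ^ CARD('w)" .
  have "w a \<in> V.span ?B" if a: "a \<in> A" for a
  proof -
    have "g v ^ a v \<in> exps_le (N * D)" if "v \<in> I" for v
    proof -
      have "a v < N" using a that unfolding A_def by auto
      then show ?thesis
        using exps_le_mono[OF exps_le_power[OF D[OF that], of "a v"]] by simp
    qed
    then have "w a \<in> exps_le M" unfolding w_def M_def by (rule exps_le_prod)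
    then have sub: "Poly_Mapping.keys (w a) \<subseteq> ?E" by (auto simp: exps_le_def)
    have "w a = (\<Sum>t\<in>Poly_Mapping.keys (w a). Const (Poly_Mapping.lookup (w a) t) * Poly_Mapping.single t 1)"
      by (subst (1) expand_singles) (simp add: mult_single)
    also have "\<dots> \<in> V.span ?B"
      by (intro V.span_sum V.span_scale V.span_base) (use sub in blast)
    finally show ?thesis .
  qed
  then have "w ` A \<subseteq> V.span ?B" by blast
  then have "card (w ` A) \<le> card ?B"
    using V.independent_span_bound[OF finite_imageI[OF finE] indep] by blast
  also have "\<dots> \<le> card ?E" by (rule card_image_le[OF finE])
  also note cardE
  finally show ?thesis by (simp add: card_image[OF w_inj] cardA M_def)
qed

text \<open>If \<open>card I\<close> exceeded the number of variables, the left-hand side of the count would grow in \<open>N\<close> with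
  a larger exponent than the right-hand side.\<close>

lemma alg_indep_card_le:
  fixes g :: "'v \<Rightarrow> ('w::finite \<Rightarrow>\<^sub>0 nat) \<Rightarrow>\<^sub>0 'k::field"
  assumes fin: "finite I" and ind: "alg_indep {0} g I"
  shows "card I \<le> CARD('w)"
proof (rule ccontr)
  assume "\<not> ?thesis"
  then have gt: "Suc CARD('w) \<le> card I" by simp
  have "\<forall>v. \<exists>D. g v \<in> exps_le D" using exps_le_exists by blast
  then obtain d where d: "\<And>v. g v \<in> exps_le (d v)" by metis
  define D where "D = (\<Sum>v\<in>I. d v)"
  have D: "g v \<in> exps_le D" if "v \<in> I" for v
    using exps_le_mono[OF d] that fin unfolding D_def by (metis member_le_sum zero_le)
  \<comment> \<open>the count reads \<open>N ^ card I \<le> (N * K) ^ CARD('w)\<close>, which fails for \<open>N > K ^ CARD('w)\<close>\<close>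
  define K where "K = card I * D + 1"
  define N where "N = K ^ CARD('w) + 1"
  have "N ^ Suc CARD('w) \<le> N ^ card I"
    by (rule power_increasing[OF gt]) (simp add: N_def)
  also have "\<dots> \<le> (card I * (N * D) + 1) ^ CARD('w)" by (rule alg_indep_count[OF fin ind D])
  also have "\<dots> \<le> (N * K) ^ CARD('w)"
  proof (rule power_mono)
    have "card I * (N * D) = N * (card I * D)" by (simp only: mult_ac)
    then have "card I * (N * D) + 1 \<le> N * (card I * D) + N * 1" using N_def by linarith
    then show "card I * (N * D) + 1 \<le> N * K" by (simp only: K_def distrib_left)
  qed simp
  also have "\<dots> = N ^ CARD('w) * K ^ CARD('w)" by (rule power_mult_distrib)
  finally have "N ^ CARD('w) * N \<le> N ^ CARD('w) * K ^ CARD('w)" by (simp only: power_Suc2)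
  moreover have "N ^ CARD('w) > 0" by (simp add: N_def)
  ultimately have "N \<le> K ^ CARD('w)" by (metis mult_le_cancel1)
  then show False by (simp add: N_def)
qed

section \<open>Chains of primes and maximal independent sets\<close>

text \<open>The elements of \<open>S\<close> stay independent all the way down the chain, and each step contributes one
  more independent element; all of them live in a ring with \<open>CARD('w)\<close> variables.\<close>

lemma prime_chain_length_le:
  fixes C :: "nat \<Rightarrow> (('w::finite \<Rightarrow>\<^sub>0 nat) \<Rightarrow>\<^sub>0 'k::field) set"
  assumes prime: "\<And>i. i \<le> l \<Longrightarrow> prime_ideal (C i)" and chain: "\<And>i. i < l \<Longrightarrow> C i \<subset> C (Suc i)"
    and fin: "finite S" and ind: "alg_indep (C l) Var S"
  shows "card S + l \<le> CARD('w)"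
proof -
  have "\<forall>i. \<exists>h. i < l \<longrightarrow> h \<in> C (Suc i) \<and> h \<notin> C i" using chain by blast
  then obtain h where h: "\<And>i. i < l \<Longrightarrow> h i \<in> C (Suc i) \<and> h i \<notin> C i" by metis
  define g where "g = case_sum Var h"
  \<comment> \<open>after \<open>j\<close> steps down the chain, the last \<open>j\<close> of the elements \<open>h i\<close> have been added\<close>
  have "alg_indep (C (l - j)) g (Inl ` S \<union> Inr ` {l - j..<l})" if "j \<le> l" for j
    using that
  proof (induction j)
    case 0
    have "alg_indep (C l) g (Inl ` S)"
      by (rule alg_indep_reindex[OF ind]) (auto simp: g_def)
    then show ?case by simp
  next
    case (Suc j)
    define i where "i = l - Suc j"
    have i: "i < l" "l - j = Suc i" using Suc.prems by (auto simp: i_def)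
    have "alg_indep (C i) g (insert (Inr i) (Inl ` S \<union> Inr ` {Suc i..<l}))"
    proof (rule alg_indep_insert_prime)
      show "prime_ideal (C i)" "ideal.subspace (C (Suc i))"
        using i by (auto intro!: prime prime_ideal_subspace)
      show "C i \<subseteq> C (Suc i)" using chain[OF i(1)] by blast
      show "g (Inr i) \<in> C (Suc i)" "g (Inr i) \<notin> C i" using h[OF i(1)] by (auto simp: g_def)
      show "alg_indep (C (Suc i)) g (Inl ` S \<union> Inr ` {Suc i..<l})" using Suc i by simp
    qed
    moreover have "insert (Inr i) (Inl ` S \<union> Inr ` {Suc i..<l}) = Inl ` S \<union> Inr ` {i..<l}"
      using i by auto
    ultimately show ?case by (simp add: i_def)
  qed
  from this[of l] have "alg_indep (C 0) g (Inl ` S \<union> Inr ` {0..<l})" by simp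
  moreover have "0 \<in> C 0"
    using ideal.subspace_0[OF prime_ideal_subspace[OF prime[of 0]]] by simp
  ultimately have "alg_indep {0} g (Inl ` S \<union> Inr ` {0..<l})"
    unfolding alg_indep_def by (metis singletonD)
  then have "card (Inl ` S \<union> Inr ` {0..<l} :: ('w + nat) set) \<le> CARD('w)"
    by (rule alg_indep_card_le[rotated]) (use fin in auto)
  also have "card (Inl ` S \<union> Inr ` {0..<l} :: ('w + nat) set) = card S + l"
    by (subst card_Un_disjoint) (use fin in \<open>auto simp: card_image\<close>)
  finally show ?thesis .
qed

lemma alg_indep_extend_to_maximal:
  fixes g :: "'v::finite \<Rightarrow> ('w \<Rightarrow>\<^sub>0 nat) \<Rightarrow>\<^sub>0 'k::comm_ring_1"
  assumes "alg_indep {0} g S"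
  obtains B where "S \<subseteq> B" "alg_indep {0} g B" "\<And>v. v \<notin> B \<Longrightarrow> \<not> alg_indep {0} g (insert v B)"
proof -
  have "finite {B. alg_indep {0} g B}" by simp
  from finite_has_maximal2[OF this, of S] assms
  obtain B where B: "alg_indep {0} g B" "S \<subseteq> B" "\<And>B'. alg_indep {0} g B' \<Longrightarrow> B \<subseteq> B' \<Longrightarrow> B = B'"
    by auto
  show ?thesis by (rule that[OF B(2,1)]) (use B(3) in blast)
qed

section \<open>Partial derivatives\<close>

lemma lookup_pderiv_var:
  "Poly_Mapping.lookup (pderiv_var i p) s =
    of_nat (Poly_Mapping.lookup s i + 1) * Poly_Mapping.lookup p (s + Poly_Mapping.single i 1)"
proof -
  let ?s = "s + Poly_Mapping.single i 1"
  \<comment> \<open>when the subtraction truncates, the coefficient is zero, so the two conditions may be exchanged\<close>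
  have "(if t - Poly_Mapping.single i 1 = s
        then of_nat (Poly_Mapping.lookup t i) * Poly_Mapping.lookup p t else 0) =
      (if t = ?s then of_nat (Poly_Mapping.lookup t i) * Poly_Mapping.lookup p t else 0)" for t
  proof (cases "Poly_Mapping.lookup t i = 0")
    case True
    then show ?thesis by (auto simp: lookup_add)
  next
    case False
    then have "t - Poly_Mapping.single i 1 + Poly_Mapping.single i 1 = t"
      by (intro poly_mapping_eqI) (auto simp: lookup_add lookup_minus lookup_single when_def)
    then have "t - Poly_Mapping.single i 1 = s \<longleftrightarrow> t = ?s"
      by (metis add_diff_cancel_right')
    then show ?thesis by simp
  qed
  then have "Poly_Mapping.lookup (pderiv_var i p) s =
      (\<Sum>t\<in>Poly_Mapping.keys p. if t = ?s
        then of_nat (Poly_Mapping.lookup t i) * Poly_Mapping.lookup p t else 0)"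
    unfolding pderiv_var_def lookup_sum lookup_single when_def by (simp only:)
  also have "\<dots> = of_nat (Poly_Mapping.lookup ?s i) * Poly_Mapping.lookup p ?s"
    by (simp add: sum.delta in_keys_iff)
  finally show ?thesis by (simp add: lookup_add)
qed

lemma pderiv_var_add: "pderiv_var i (p + q) = pderiv_var i p + pderiv_var i q"
  by (rule poly_mapping_eqI) (simp only: lookup_pderiv_var lookup_add distrib_left)

lemma pderiv_var_0 [simp]: "pderiv_var i 0 = 0"
  by (simp add: pderiv_var_def)

lemma pderiv_var_sum: "pderiv_var i (\<Sum>a\<in>A. p a) = (\<Sum>a\<in>A. pderiv_var i (p a))"
  by (induction A rule: infinite_finite_induct) (simp_all add: pderiv_var_add)

lemma pderiv_var_single:
  "pderiv_var i (Poly_Mapping.single t c) =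
    Poly_Mapping.single (t - Poly_Mapping.single i 1) (of_nat (Poly_Mapping.lookup t i) * c)"
  by (cases "c = 0") (simp_all add: pderiv_var_def)

lemma pderiv_var_Const [simp]: "pderiv_var i (Const c) = 0"
  by (simp add: pderiv_var_single)

lemma pderiv_var_Var: "pderiv_var i (Var j) = (if i = j then 1 else 0)"
  by (auto simp: Var_def pderiv_var_single lookup_single when_def)

lemma pderiv_var_mult: "pderiv_var i (p * q) = pderiv_var i p * q + p * pderiv_var i q"
proof -
  let ?e = "Poly_Mapping.single i 1"
  have s: "pderiv_var i (Poly_Mapping.single t a * Poly_Mapping.single s b) =
      pderiv_var i (Poly_Mapping.single t a) * Poly_Mapping.single s b +
      Poly_Mapping.single t a * pderiv_var i (Poly_Mapping.single s b)" for t s a b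
  proof -
    have 1: "Poly_Mapping.single (t + s - ?e) (of_nat (Poly_Mapping.lookup t i) * (a * b)) =
        Poly_Mapping.single (t - ?e + s) (of_nat (Poly_Mapping.lookup t i) * a * b)"
    proof (cases "Poly_Mapping.lookup t i = 0")
      case False
      then have "t + s - ?e = t - ?e + s"
        by (intro poly_mapping_eqI) (auto simp: lookup_add lookup_minus lookup_single when_def)
      then show ?thesis by (simp only: mult.assoc)
    qed simp
    have 2: "Poly_Mapping.single (t + s - ?e) (of_nat (Poly_Mapping.lookup s i) * (a * b)) =
        Poly_Mapping.single (t + (s - ?e)) (a * (of_nat (Poly_Mapping.lookup s i) * b))"
    proof (cases "Poly_Mapping.lookup s i = 0")
      case False
      then have "t + s - ?e = t + (s - ?e)"
        by (intro poly_mapping_eqI) (auto simp: lookup_add lookup_minus lookup_single when_def)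
      then show ?thesis by (simp only: mult_ac)
    qed simp
    show ?thesis
      by (simp only: mult_single pderiv_var_single lookup_add of_nat_add distrib_right single_add 1 2)
  qed
  have "pderiv_var i (p * q) =
      (\<Sum>t\<in>Poly_Mapping.keys p. \<Sum>s\<in>Poly_Mapping.keys q. pderiv_var i
        (Poly_Mapping.single t (Poly_Mapping.lookup p t) * Poly_Mapping.single s (Poly_Mapping.lookup q s)))"
    by (subst expand_singles[of p], subst expand_singles[of q]) (simp only: sum_product pderiv_var_sum)
  also have "\<dots> =
      pderiv_var i (\<Sum>t\<in>Poly_Mapping.keys p. Poly_Mapping.single t (Poly_Mapping.lookup p t)) *
        (\<Sum>s\<in>Poly_Mapping.keys q. Poly_Mapping.single s (Poly_Mapping.lookup q s)) +
      (\<Sum>t\<in>Poly_Mapping.keys p. Poly_Mapping.single t (Poly_Mapping.lookup p t)) *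
        pderiv_var i (\<Sum>s\<in>Poly_Mapping.keys q. Poly_Mapping.single s (Poly_Mapping.lookup q s))"
    by (simp only: s sum_product pderiv_var_sum sum.distrib)
  finally show ?thesis by (simp only: expand_singles[symmetric])
qed

text \<open>The chain rule: both sides are additive in \<open>F\<close> and obey the same product rule.\<close>

lemma pderiv_var_peval:
  fixes g :: "'v::finite \<Rightarrow> ('w::finite, 'k::field_char_0) mpoly"
  shows "pderiv_var i (peval Const g F) = (\<Sum>v\<in>UNIV. peval Const g (pderiv_var v F) * pderiv_var i (g v))"
proof -
  interpret ev: comm_ring_hom "peval Const g"
    by (rule comm_ring_hom_peval[OF comm_ring_hom_Const])
  show ?thesis
  proof (induction F rule: mpoly_induct)
    case (Const c)
    show ?case by (simp add: peval_Const[OF comm_ring_hom_Const])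
  next
    case (Var v)
    have "(\<Sum>w\<in>UNIV. peval Const g (pderiv_var w (Var v)) * pderiv_var i (g w)) =
        (\<Sum>w\<in>UNIV. if w = v then pderiv_var i (g w) else 0)"
      by (rule sum.cong) (auto simp: pderiv_var_Var)
    then show ?case by (simp add: peval_Var[OF comm_ring_hom_Const])
  next
    case (add F G)
    then show ?case
      by (simp only: pderiv_var_add ev.hom_add distrib_right sum.distrib)
  next
    case (mult F G)
    let ?a = "peval Const g F" and ?b = "peval Const g G"
    have "(\<Sum>v\<in>UNIV. peval Const g (pderiv_var v (F * G)) * pderiv_var i (g v)) =
        (\<Sum>v\<in>UNIV. (peval Const g (pderiv_var v F) * pderiv_var i (g v)) * ?b +
          ?a * (peval Const g (pderiv_var v G) * pderiv_var i (g v)))"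
      by (rule sum.cong[OF refl]) (simp only: pderiv_var_mult ev.hom_add ev.hom_mult distrib_right distrib_left mult_ac)
    also have "\<dots> = pderiv_var i ?a * ?b + ?a * pderiv_var i ?b"
      by (simp only: sum.distrib sum_distrib_left sum_distrib_right mult)
    finally show ?case by (simp only: ev.hom_mult pderiv_var_mult)
  qed
qed

lemma differential_peval:
  fixes g :: "'v::finite \<Rightarrow> ('w::finite, 'k::field_char_0) mpoly"
  shows "differential (peval Const g F) = (\<Sum>v\<in>UNIV. peval Const g (pderiv_var v F) *s differential (g v))"
  by (simp add: differential_def pderiv_var_peval Finite_Cartesian_Product.vec_eq_iff sum_component)

lemma differential_Var: "differential (Var i) = axis i 1"
  by (simp add: differential_def pderiv_var_Var Finite_Cartesian_Product.vec_eq_iff axis_def)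

lemma keys_pderiv_var:
  assumes "s \<in> Poly_Mapping.keys (pderiv_var i p)"
  shows "s + Poly_Mapping.single i 1 \<in> Poly_Mapping.keys p"
  using assms by (auto simp: in_keys_iff lookup_pderiv_var)

lemma pderiv_var_polys_in:
  assumes "F \<in> polys_in I"
  shows "pderiv_var i F \<in> polys_in I"
  unfolding polys_in_def
proof safe
  fix s v
  assume s: "s \<in> Poly_Mapping.keys (pderiv_var i F)" and v: "v \<in> Poly_Mapping.keys s"
  have "Poly_Mapping.keys (s + Poly_Mapping.single i 1) \<subseteq> I"
    using assms keys_pderiv_var[OF s] by (auto simp: polys_in_def)
  moreover have "v \<in> Poly_Mapping.keys (s + Poly_Mapping.single i 1)"
    using v by (simp add: in_keys_iff lookup_add)
  ultimately show "v \<in> I" by blast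
qed

lemma pderiv_var_not_in:
  assumes "F \<in> polys_in I" "i \<notin> I"
  shows "pderiv_var i F = 0"
proof (rule poly_mapping_eqI)
  fix s
  have "i \<in> Poly_Mapping.keys (s + Poly_Mapping.single i (1::nat))"
    by (simp add: in_keys_iff lookup_add)
  then have "s + Poly_Mapping.single i 1 \<notin> Poly_Mapping.keys F"
    using assms by (auto simp: polys_in_def)
  then show "Poly_Mapping.lookup (pderiv_var i F) s = Poly_Mapping.lookup 0 s"
    by (simp add: lookup_pderiv_var in_keys_iff)
qed

lemma polys_in_if_pderiv_var_0:
  assumes F: "F \<in> polys_in (insert i I)" and d: "pderiv_var i F = 0"
  shows "F \<in> polys_in I"
  unfolding polys_in_def
proof safe
  fix t v
  assume t: "t \<in> Poly_Mapping.keys F" and v: "v \<in> Poly_Mapping.keys t"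
  have "Poly_Mapping.lookup t i = 0"
  proof (rule ccontr)
    assume nz: "Poly_Mapping.lookup t i \<noteq> 0"
    let ?s = "t - Poly_Mapping.single i 1"
    have "?s + Poly_Mapping.single i 1 = t"
      using nz by (intro poly_mapping_eqI) (auto simp: lookup_add lookup_minus lookup_single when_def)
    then have "Poly_Mapping.lookup (pderiv_var i F) ?s =
        of_nat (Poly_Mapping.lookup ?s i + 1) * Poly_Mapping.lookup F t"
      by (simp only: lookup_pderiv_var)
    moreover have "Poly_Mapping.lookup F t \<noteq> 0" using t by (simp add: in_keys_iff)
    ultimately show False unfolding d lookup_zero
      by (metis Suc_eq_plus1 mult_eq_0_iff of_nat_neq_0)
  qed
  then have "v \<noteq> i" using v by (auto simp: in_keys_iff)
  then show "v \<in> I" using F t v by (auto simp: polys_in_def)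
qed

definition total_exp :: "('v::finite \<Rightarrow>\<^sub>0 nat) \<Rightarrow> nat" where
  "total_exp t = (\<Sum>v\<in>UNIV. Poly_Mapping.lookup t v)"

text \<open>For a relation \<open>F\<close> of least total degree, the derivative \<open>\<partial>F/\<partial>v\<close> has smaller degree, so if it
  were again a relation it would have to be zero. In characteristic zero \<open>F\<close> would then not involve
  \<open>v\<close>, contradicting the independence of \<open>B\<close>.\<close>

lemma minimal_relation:
  fixes g :: "'v::finite \<Rightarrow> ('w::finite, 'k::field_char_0) mpoly"
  assumes ind: "alg_indep {0} g B" and dep: "\<not> alg_indep {0} g (insert v B)"
  obtains F where "F \<in> polys_in (insert v B)" "peval Const g F = 0"
    "peval Const g (pderiv_var v F) \<noteq> 0"
proof -
  define rel where "rel N F \<longleftrightarrow> F \<in> polys_in (insert v B) \<and> peval Const g F = 0 \<and> F \<noteq> 0 \<and>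
    (\<forall>t\<in>Poly_Mapping.keys F. total_exp t \<le> N)" for N F
  obtain F0 where F0: "F0 \<in> polys_in (insert v B)" "peval Const g F0 = 0" "F0 \<noteq> 0"
    using dep unfolding alg_indep_def by auto
  have "rel (Max (total_exp ` Poly_Mapping.keys F0)) F0"
    using F0 unfolding rel_def by simp
  then have ex: "\<exists>N F. rel N F" by blast
  define N where "N = (LEAST N. \<exists>F. rel N F)"
  have "\<exists>F. rel N F" unfolding N_def by (rule LeastI_ex) (rule ex)
  then obtain F where F: "rel N F" by blast
  have least: "N \<le> M" if "rel M G" for M G
    unfolding N_def by (rule Least_le) (use that in blast)
  have poly: "F \<in> polys_in (insert v B)" and F0: "peval Const g F = 0" "F \<noteq> 0"
    using F by (auto simp: rel_def)
  have "peval Const g (pderiv_var v F) \<noteq> 0"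
  proof
    assume z: "peval Const g (pderiv_var v F) = 0"
    have le: "Suc (total_exp s) \<le> N" if "s \<in> Poly_Mapping.keys (pderiv_var v F)" for s
    proof -
      have "total_exp (s + Poly_Mapping.single v 1) \<le> N"
        using F keys_pderiv_var[OF that] by (auto simp: rel_def)
      moreover have "total_exp (s + Poly_Mapping.single v 1) = Suc (total_exp s)"
        by (simp add: total_exp_def lookup_add sum.distrib lookup_single when_def)
      ultimately show ?thesis by simp
    qed
    have "pderiv_var v F = 0"
    proof (rule ccontr)
      assume nz: "pderiv_var v F \<noteq> 0"
      then obtain s where "s \<in> Poly_Mapping.keys (pderiv_var v F)" by (metis all_not_in_conv keys_eq_empty)
      then have pos: "N > 0" using le by fastforce
      have "rel (N - 1) (pderiv_var v F)"
        unfolding rel_def using nz z pderiv_var_polys_in[OF poly] le by fastforce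
      then have "N \<le> N - 1" by (rule least)
      then show False using pos by simp
    qed
    then have "F \<in> polys_in B" by (rule polys_in_if_pderiv_var_0[OF poly])
    then show False using ind F0 unfolding alg_indep_def by blast
  qed
  then show ?thesis using that poly F0(1) by blast
qed

section \<open>Differentials of algebraically independent polynomials\<close>

text \<open>The Jacobian criterion in characteristic zero. The point is to find at most \<open>n\<close> differentials,
  those of \<open>f\<^sub>j\<close>, \<open>j \<in> S\<close>, among them, that generically span a space of dimension \<open>n\<close>.\<close>

lemma free_differentials_if_alg_indep:
  fixes f :: "('n::{finite,linorder}, 'k::field_char_0) mpoly ^ 'm::finite"
  assumes S: "alg_indep {0} (\<lambda>j. f $ j) S"
  shows "free_family (\<lambda>j. differential (f $ j)) S"
proof -
  define g :: "'m + 'n \<Rightarrow> ('n, 'k) mpoly" where "g = case_sum (\<lambda>j. f $ j) Var"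
  define h where "h v = differential (g v)" for v
  have "alg_indep {0} g (Inl ` S)"
    by (rule alg_indep_reindex[OF S]) (auto simp: g_def)
  then obtain B where SB: "Inl ` S \<subseteq> B" and B: "alg_indep {0} g B"
    and max: "\<And>v. v \<notin> B \<Longrightarrow> \<not> alg_indep {0} g (insert v B)"
    by (rule alg_indep_extend_to_maximal) blast
  have cardB: "card B \<le> CARD('n)" by (rule alg_indep_card_le[OF _ B]) simp
  have gen: "\<exists>b. b \<noteq> 0 \<and> b *s axis i 1 \<in> rmod.span (h ` B)" for i :: 'n
  proof (cases "Inr i \<in> B")
    case True
    have "h (Inr i) = axis i 1" by (simp add: h_def g_def differential_Var)
    then have "1 *s axis i 1 \<in> rmod.span (h ` B)"
      using rmod.span_base[OF imageI[OF True, of h]] by simp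
    then show ?thesis by (intro exI[of _ 1]) simp
  next
    case False
    obtain F where F: "F \<in> polys_in (insert (Inr i) B)" "peval Const g F = 0"
      "peval Const g (pderiv_var (Inr i) F) \<noteq> 0"
      using minimal_relation[OF B max[OF False]] by blast
    \<comment> \<open>the chain rule applied to the relation; only the variables of \<open>F\<close> contribute\<close>
    have "0 = (\<Sum>v\<in>UNIV. peval Const g (pderiv_var v F) *s h v)"
      using differential_peval[of g F] F(2) by (simp add: h_def differential_def Finite_Cartesian_Product.vec_eq_iff)
    also have "\<dots> = (\<Sum>v\<in>insert (Inr i) B. peval Const g (pderiv_var v F) *s h v)"
      by (rule sum.mono_neutral_right)
        (auto simp: pderiv_var_not_in[OF F(1)] peval_0[OF comm_ring_hom_Const])
    also have "\<dots> = peval Const g (pderiv_var (Inr i) F) *s h (Inr i) +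
        (\<Sum>v\<in>B. peval Const g (pderiv_var v F) *s h v)"
      by (rule sum.insert) (simp_all add: False)
    finally have "peval Const g (pderiv_var (Inr i) F) *s h (Inr i) =
        - (\<Sum>v\<in>B. peval Const g (pderiv_var v F) *s h v)"
      unfolding eq_neg_iff_add_eq_0 by (rule sym)
    also have "\<dots> \<in> rmod.span (h ` B)"
      by (intro rmod.span_neg rmod.span_sum rmod.span_scale rmod.span_base imageI)
    finally have "peval Const g (pderiv_var (Inr i) F) *s axis i 1 \<in> rmod.span (h ` B)"
      by (simp add: h_def g_def differential_Var)
    then show ?thesis using F(3) by (intro exI conjI)
  qed
  have "free_family (h :: 'm + 'n \<Rightarrow> _) {}" by (simp add: free_family_def)
  from free_family_extend_to_basis[OF _ this _ gen]
  obtain Y where Y: "Y \<subseteq> h ` B" "card Y = CARD('n)" "free_family (\<lambda>v. v) Y" by auto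
  \<comment> \<open>a basis chosen among at most \<open>n\<close> vectors uses all of them, without repetition\<close>
  have "card (h ` B) \<le> card B" by (rule card_image_le) simp
  then have "card (h ` B) \<le> card Y" using cardB Y(2) by simp
  then have YB: "Y = h ` B" using Y(1) by (intro card_seteq) auto
  have "card (h ` B) = card B"
    using \<open>card (h ` B) \<le> card B\<close> cardB Y(2) YB by simp
  then have "inj_on h B" by (intro eq_card_imp_inj_on) auto
  then have "free_family h B"
    using free_family_reindex[of h B "\<lambda>v. v"] Y(3) YB by simp
  then have "free_family h (Inl ` S)" using SB by (rule free_family_subset) simp
  then have "free_family (\<lambda>j. h (Inl j)) S"
    by (rule free_family_reindex[rotated]) simp
  then show ?thesis by (simp add: h_def g_def)
qed

section \<open>The height of the relation ideal\<close>

lemma psubst_eq_peval: "psubst f F = peval Const (\<lambda>j. f $ j) F"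
  unfolding psubst_def peval_def
  by (intro sum.cong refl arg_cong2[where f = "(*)"] mon_superset[symmetric]) auto

lemma comm_ring_hom_psubst: "comm_ring_hom (psubst f)"
  using comm_ring_hom_peval[OF comm_ring_hom_Const, of "\<lambda>j. f $ j"]
  by (simp only: psubst_eq_peval[abs_def])

lemma prime_ideal_kernel:
  fixes \<psi> :: "'a::comm_ring_1 \<Rightarrow> 'b::idom"
  assumes "comm_ring_hom \<psi>"
  shows "prime_ideal {F. \<psi> F = 0}"
proof -
  interpret comm_ring_hom \<psi> by fact
  show ?thesis
    unfolding prime_ideal_def ideal.subspace_def
  proof (intro conjI allI impI)
    show "{F. \<psi> F = 0} \<noteq> UNIV"
    proof
      assume "{F. \<psi> F = 0} = UNIV"
      then have "\<psi> 1 = 0" by blast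
      then show False by simp
    qed
  qed (auto simp: hom_add hom_mult)
qed

context
  fixes f :: "('n::{finite,linorder}, 'k::field_char_0) mpoly ^ ('m::{finite,linorder})"
begin

text \<open>The map \<open>k[T] \<rightarrow> R[T]\<close> with \<open>T\<^sub>j \<mapsto> f\<^sub>j\<close> for \<open>j \<in> S\<close> and \<open>T\<^sub>j \<mapsto> T\<^sub>j\<close> otherwise. Its kernels form the
  chain of primes below the relation ideal.\<close>

definition partial_subst :: "'m set \<Rightarrow> ('m, 'k) mpoly \<Rightarrow> ('m \<Rightarrow>\<^sub>0 nat) \<Rightarrow>\<^sub>0 (('n, 'k) mpoly)" where
  "partial_subst S = peval (\<lambda>c. Const (Const c)) (\<lambda>j. if j \<in> S then Const (f $ j) else Var j)"

lemma comm_ring_hom_Const_Const: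
  "comm_ring_hom (\<lambda>c. Const (Const c) :: ('m \<Rightarrow>\<^sub>0 nat) \<Rightarrow>\<^sub>0 (('n, 'k) mpoly))"
  by unfold_locales (simp_all add: single_add mult_single)

lemma comm_ring_hom_partial_subst: "comm_ring_hom (partial_subst S)"
  unfolding partial_subst_def by (rule comm_ring_hom_peval[OF comm_ring_hom_Const_Const])

lemma partial_subst_polys_in:
  assumes "F \<in> polys_in S"
  shows "partial_subst S F = Const (psubst f F)"
proof -
  have "partial_subst S F = peval (\<lambda>c. Const (Const c)) (\<lambda>j. Const (f $ j)) F"
    unfolding partial_subst_def by (rule peval_cong[OF assms]) (simp only: if_True)
  also have "\<dots> = Const (psubst f F)"
    unfolding psubst_eq_peval by (rule hom_peval[OF comm_ring_hom_Const, symmetric])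
  finally show ?thesis .
qed

definition partial_relations :: "'m set \<Rightarrow> ('m, 'k) mpoly set" where
  "partial_relations S = {F. partial_subst S F = 0}"

lemma prime_ideal_partial_relations: "prime_ideal (partial_relations S)"
  unfolding partial_relations_def by (rule prime_ideal_kernel[OF comm_ring_hom_partial_subst])

lemma Const_eq_0_iff: "Const c = 0 \<longleftrightarrow> c = 0"
  by (metis lookup_single_eq lookup_zero single_zero)

lemma partial_relations_UNIV: "partial_relations UNIV = relation_ideal f"
proof -
  have "F \<in> polys_in UNIV" for F :: "('m, 'k) mpoly" by (simp add: polys_in_def)
  then show ?thesis
    by (simp add: partial_relations_def relation_ideal_def partial_subst_polys_in Const_eq_0_iff)
qed

text \<open>The substitution for \<open>T\<close> factors through the one for \<open>S\<close>.\<close>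

lemma partial_relations_mono:
  assumes "S \<subseteq> T"
  shows "partial_relations S \<subseteq> partial_relations T"
proof
  define \<psi> where "\<psi> = peval Const (\<lambda>j. if j \<in> T then Const (f $ j) else Var j)"
  interpret \<psi>: comm_ring_hom \<psi>
    unfolding \<psi>_def by (rule comm_ring_hom_peval[OF comm_ring_hom_Const])
  fix F assume F: "F \<in> partial_relations S"
  have "\<psi> (partial_subst S F) = partial_subst T F"
    unfolding partial_subst_def hom_peval[OF \<psi>.comm_ring_hom_axioms]
    by (intro arg_cong2[where f = "\<lambda>a b. peval a b F"] ext)
      (use assms in \<open>auto simp: \<psi>_def peval_Const[OF comm_ring_hom_Const] peval_Var[OF comm_ring_hom_Const]\<close>)
  then show "F \<in> partial_relations T" using F by (simp add: partial_relations_def)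
qed

text \<open>As the variable with index \<open>j\<close> is not substituted, the coefficients of its powers in \<open>F\<close> must vanish separately, and
  these involve only the independent \<open>f\<^sub>i\<close>, \<open>i \<in> S\<close>.\<close>

lemma relation_notin_partial_relations:
  assumes ind: "alg_indep {0} (\<lambda>j. f $ j) S" and ST: "S \<subseteq> T" and j: "j \<notin> T"
    and F: "F \<in> polys_in (insert j S)" "F \<noteq> 0"
  shows "F \<notin> partial_relations T"
proof
  interpret p: comm_ring_hom "partial_subst T" by (rule comm_ring_hom_partial_subst)
  assume "F \<in> partial_relations T"
  then have z: "partial_subst T F = 0" by (simp add: partial_relations_def)
  obtain N where N: "F = (\<Sum>i\<le>N. slice j i F * Var j ^ i)" using slice_expansion[of F j] by (rule exE)
  have slice: "slice j i F \<in> polys_in S" for i by (rule slice_polys_in[OF F(1)])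
  then have sliceT: "slice j i F \<in> polys_in T" for i using polys_in_mono[OF ST] by blast
  have pj: "partial_subst T (Var j) = Var j"
    using j by (simp add: partial_subst_def peval_Var[OF comm_ring_hom_Const_Const])
  have "partial_subst T F = (\<Sum>i\<le>N. partial_subst T (slice j i F) * Var j ^ i)"
    by (subst N) (simp only: p.hom_sum p.hom_mult p.hom_power pj)
  also have "\<dots> = (\<Sum>i\<le>N. Poly_Mapping.single (Poly_Mapping.single j i) (psubst f (slice j i F)))"
    by (simp add: partial_subst_polys_in[OF sliceT] Var_power mult_single)
  finally have sum0: "(\<Sum>i\<le>N. Poly_Mapping.single (Poly_Mapping.single j i) (psubst f (slice j i F))) = 0"
    using z by simp
  have "slice j i F = 0" if i: "i \<le> N" for i
  proof -
    have "psubst f (slice j i F) = Poly_Mapping.lookup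
        (\<Sum>i\<le>N. Poly_Mapping.single (Poly_Mapping.single j i) (psubst f (slice j i F))) (Poly_Mapping.single j i)"
      using i by (simp add: lookup_sum lookup_single when_def inj_eq[OF inj_single] sum.delta)
    also have "\<dots> = 0" by (simp only: sum0 lookup_zero)
    finally show ?thesis
      using ind slice unfolding alg_indep_def psubst_eq_peval by blast
  qed
  then have "F = 0" by (subst N) simp
  then show False using F(2) by contradiction
qed

text \<open>The upper bound is the bound on chains of primes. For the lower bound, the indices outside \<open>S\<close> are
  substituted one after the other; each step is strict, by a relation that involves the new index.\<close>

lemma height_relation_ideal:
  assumes ind: "alg_indep {0} (\<lambda>j. f $ j) S"
    and max: "\<And>j. j \<notin> S \<Longrightarrow> \<not> alg_indep {0} (\<lambda>j. f $ j) (insert j S)"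
  shows "height (relation_ideal f) = enat (CARD('m) - card S)"
proof (rule antisym)
  show "height (relation_ideal f) \<le> enat (CARD('m) - card S)"
    unfolding height_def
  proof (rule Sup_least, clarify)
    fix l and C :: "nat \<Rightarrow> ('m, 'k) mpoly set"
    assume prime: "\<forall>i\<le>l. prime_ideal (C i)" and chain: "\<forall>i<l. C i \<subset> C (Suc i)"
      and last: "C l = relation_ideal f"
    have "alg_indep (C l) Var S"
      using ind unfolding alg_indep_def last peval_id relation_ideal_def psubst_eq_peval by simp
    then have "card S + l \<le> CARD('m)"
      by (rule prime_chain_length_le[rotated 3]) (use prime chain in auto)
    then show "enat l \<le> enat (CARD('m) - card S)" by simp
  qed
next
  define l where "l = CARD('m) - card S"
  have l: "card (- S) = l" by (simp add: l_def Compl_eq_Diff_UNIV card_Diff_subset)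
  obtain e where e: "bij_betw e {0..<l} (- S)"
    using ex_bij_betw_nat_finite[of "- S"] l by auto
  define T where "T i = S \<union> e ` {0..<i}" for i
  have "partial_relations (T i) \<subset> partial_relations (T (Suc i))" if i: "i < l" for i
  proof
    show "partial_relations (T i) \<subseteq> partial_relations (T (Suc i))"
      by (rule partial_relations_mono) (auto simp: T_def)
    have eS: "e i \<notin> S" using bij_betwE[OF e] i by simp
    have "e i \<notin> e ` {0..<i}"
      using inj_on_image_mem_iff[OF bij_betw_imp_inj_on[OF e], of i "{0..<i}"] i by auto
    then have eT: "e i \<notin> T i" using eS by (simp add: T_def)
    obtain F where F: "F \<in> polys_in (insert (e i) S)" "peval Const (\<lambda>j. f $ j) F \<in> {0}" "F \<noteq> 0"
      using max[OF eS] unfolding alg_indep_def by blast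
    have "F \<in> polys_in (T (Suc i))" by (rule subsetD[OF polys_in_mono F(1)]) (auto simp: T_def)
    then have "F \<in> partial_relations (T (Suc i))"
      using F(2) by (simp add: partial_relations_def partial_subst_polys_in psubst_eq_peval)
    moreover have "F \<notin> partial_relations (T i)"
      by (rule relation_notin_partial_relations[OF ind _ eT F(1,3)]) (simp add: T_def)
    ultimately show "partial_relations (T i) \<noteq> partial_relations (T (Suc i))" by blast
  qed
  moreover have "T l = UNIV" using bij_betw_imp_surj_on[OF e] by (auto simp: T_def)
  then have "partial_relations (T l) = relation_ideal f" by (simp only: partial_relations_UNIV)
  ultimately show "enat (CARD('m) - card S) \<le> height (relation_ideal f)"
    unfolding height_def l_def[symmetric]
    by (intro Sup_upper CollectI exI[of _ l] exI[of _ "\<lambda>i. partial_relations (T i)"] conjI)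
      (simp_all add: prime_ideal_partial_relations)
qed

end

section \<open>Polar and differential syzygies\<close>

definition polar_gradient ::
    "('n::finite, 'k::field_char_0) mpoly ^ 'm \<Rightarrow> ('m::finite, 'k) mpoly \<Rightarrow> ('n, 'k) mpoly ^ 'm" where
  "polar_gradient f F = (\<chi> j. psubst f (pderiv_var j F))"

lemma polar_syzygies_eq: "polar_syzygies f = rmod.span (polar_gradient f ` relation_ideal f)"
  by (simp add: polar_syzygies_def polar_gradient_def[abs_def])

lemma relation_ideal_subspace: "ideal.subspace (relation_ideal f)"
proof -
  interpret comm_ring_hom "psubst f" by (rule comm_ring_hom_psubst)
  show ?thesis unfolding ideal.subspace_def relation_ideal_def by (auto simp: hom_add hom_mult)
qed

lemma polar_gradient_mult:
  assumes "F \<in> relation_ideal f"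
  shows "polar_gradient f (a * F) = psubst f a *s polar_gradient f F"
proof -
  interpret comm_ring_hom "psubst f" by (rule comm_ring_hom_psubst)
  show ?thesis using assms
    by (simp add: polar_gradient_def relation_ideal_def pderiv_var_mult hom_add hom_mult
        Finite_Cartesian_Product.vec_eq_iff)
qed

lemma polar_gradient_add: "polar_gradient f (F + G) = polar_gradient f F + polar_gradient f G"
proof -
  interpret comm_ring_hom "psubst f" by (rule comm_ring_hom_psubst)
  show ?thesis
    by (simp add: polar_gradient_def pderiv_var_add hom_add Finite_Cartesian_Product.vec_eq_iff)
qed

text \<open>By the product rule the gradient at \<open>f\<close> is linear on the relation ideal: the term that
  differentiates the cofactor is multiplied by a relation, which vanishes at \<open>f\<close>.\<close>

lemma polar_gradient_in_span_generators:
  assumes gens: "ideal.span G = relation_ideal f" and F: "F \<in> relation_ideal f"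
  shows "polar_gradient f F \<in> rmod.span (polar_gradient f ` G)"
proof -
  interpret h: comm_ring_hom "psubst f" by (rule comm_ring_hom_psubst)
  let ?V = "{F \<in> relation_ideal f. polar_gradient f F \<in> rmod.span (polar_gradient f ` G)}"
  have sub: "ideal.subspace ?V"
  proof (rule ideal.subspaceI)
    have "polar_gradient f 0 = 0"
      by (simp add: polar_gradient_def Finite_Cartesian_Product.vec_eq_iff)
    then show "0 \<in> ?V"
      using ideal.subspace_0[OF relation_ideal_subspace] by (simp add: rmod.span_zero)
  next
    fix F H assume "F \<in> ?V" "H \<in> ?V"
    then show "F + H \<in> ?V"
      by (simp add: polar_gradient_add rmod.span_add ideal.subspace_add[OF relation_ideal_subspace])
  next
    fix a F assume "F \<in> ?V"
    then show "a * F \<in> ?V"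
      by (simp add: polar_gradient_mult rmod.span_scale ideal.subspace_scale[OF relation_ideal_subspace])
  qed
  have "G \<subseteq> ?V"
    using ideal.span_superset[of G] unfolding gens by (auto intro: rmod.span_base)
  then have "ideal.span G \<subseteq> ?V" by (rule ideal.span_minimal) (rule sub)
  then show ?thesis using F unfolding gens by blast
qed

lemma diff_syzygies_subspace: "rmod.subspace (diff_syzygies f)"
proof (rule rmod.subspaceI)
  show "0 \<in> diff_syzygies f" by (simp add: diff_syzygies_def)
next
  fix u v assume "u \<in> diff_syzygies f" "v \<in> diff_syzygies f"
  then show "u + v \<in> diff_syzygies f"
    by (simp add: diff_syzygies_def rmod.scale_left_distrib sum.distrib)
next
  fix a v assume v: "v \<in> diff_syzygies f"
  have "(\<Sum>j\<in>UNIV. (a *s v) $ j *s differential (f $ j)) =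
      a *s (\<Sum>j\<in>UNIV. v $ j *s differential (f $ j))"
    by (simp only: rmod.scale_sum_right vector_smult_component vector_smult_assoc)
  then show "a *s v \<in> diff_syzygies f" using v by (simp add: diff_syzygies_def)
qed

text \<open>The quotient by the module of differential syzygies is torsion-free.\<close>

lemma diff_syzygies_cancel:
  fixes f :: "('n::{finite,linorder}, 'k::field_char_0) mpoly ^ 'm::finite"
  assumes "a \<noteq> 0" "a *s v \<in> diff_syzygies f"
  shows "v \<in> diff_syzygies f"
proof -
  have "a *s (\<Sum>j\<in>UNIV. v $ j *s differential (f $ j)) =
      (\<Sum>j\<in>UNIV. (a *s v) $ j *s differential (f $ j))"
    by (simp only: rmod.scale_sum_right vector_smult_component vector_smult_assoc)
  also have "\<dots> = 0" using assms(2) by (simp add: diff_syzygies_def)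
  finally show ?thesis using assms(1)
    by (simp add: diff_syzygies_def Finite_Cartesian_Product.vec_eq_iff)
qed

lemma polar_subset_diff_syzygies: "polar_syzygies f \<subseteq> diff_syzygies f"
  unfolding polar_syzygies_eq
proof (rule rmod.span_minimal[OF _ diff_syzygies_subspace], clarify)
  fix F assume "F \<in> relation_ideal f"
  then have "differential (psubst f F) = 0"
    by (simp add: relation_ideal_def differential_def Finite_Cartesian_Product.vec_eq_iff)
  moreover have "differential (psubst f F) = (\<Sum>j\<in>UNIV. polar_gradient f F $ j *s differential (f $ j))"
    unfolding psubst_eq_peval differential_peval by (simp add: polar_gradient_def psubst_eq_peval)
  ultimately show "polar_gradient f F \<in> diff_syzygies f" by (simp add: diff_syzygies_def)
qed

text \<open>Cramer's rule solves \<open>\<Delta> z = \<Sum> r\<^sub>a w\<^sub>a\<close> on the \<open>g\<close> columns selected by \<open>c\<close>. The error \<open>u\<close> is a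
  syzygy that vanishes on these columns. If \<open>\<Delta>\<close> and \<open>u\<close> were nonzero, the unit vectors of \<open>S\<close>, the
  rows \<open>w\<^sub>a\<close> and \<open>u\<close> would form a free family of \<open>m + 1\<close> vectors: a syzygy supported on \<open>S\<close> is zero
  by the independence of the differentials.\<close>

lemma det_scales_syzygy_into_span:
  fixes f :: "('n::{finite,linorder}, 'k::field_char_0) mpoly ^ 'm::finite"
  assumes ind: "alg_indep {0} (\<lambda>j. f $ j) S" and card: "card S + g = CARD('m)"
    and w: "\<And>a. a < g \<Longrightarrow> w a \<in> diff_syzygies f" and z: "z \<in> diff_syzygies f"
  shows "Determinant.det (Matrix.mat g g (\<lambda>(a, b). w a $ c b)) *s z \<in> rmod.span (w ` {..<g})"
proof -
  let ?D = "Determinant.det (Matrix.mat g g (\<lambda>(a, b). w a $ c b))"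
  obtain B where adj: "\<forall>a<g. \<forall>b<g. (\<Sum>k<g. w a $ c k * B k b) = (if a = b then ?D else 0) \<and>
      (\<Sum>k<g. B a k * w k $ c b) = (if a = b then ?D else 0)"
    using adjugate_entries[where M = "\<lambda>a b. w a $ c b" and g = g] by (rule exE)
  have B: "(\<Sum>k<g. B a k * w k $ c b) = (if a = b then ?D else 0)" if "a < g" "b < g" for a b
    using adj that by simp
  \<comment> \<open>\<open>r = z\<^sub>c adj(W)\<close>, where \<open>z\<^sub>c\<close> and \<open>W\<close> are the selected columns of \<open>z\<close> and of the rows \<open>w\<^sub>a\<close>\<close>
  define r where "r a = (\<Sum>b<g. z $ c b * B b a)" for a
  have span: "(\<Sum>a<g. r a *s w a) \<in> rmod.span (w ` {..<g})"
    by (intro rmod.span_sum rmod.span_scale rmod.span_base) simp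
  define u where "u = ?D *s z - (\<Sum>a<g. r a *s w a)"
  have uZ: "u \<in> diff_syzygies f"
    unfolding u_def
    by (intro rmod.subspace_diff[OF diff_syzygies_subspace] rmod.subspace_scale[OF diff_syzygies_subspace]
        rmod.subspace_sum[OF diff_syzygies_subspace] z w) simp
  have uc: "u $ c b = 0" if b: "b < g" for b
  proof -
    have "(\<Sum>a<g. r a * w a $ c b) = (\<Sum>a<g. \<Sum>i<g. z $ c i * (B i a * w a $ c b))"
      unfolding r_def sum_distrib_right by (simp only: mult.assoc)
    also have "\<dots> = (\<Sum>i<g. z $ c i * (\<Sum>a<g. B i a * w a $ c b))"
      unfolding sum_distrib_left by (rule sum.swap)
    also have "\<dots> = (\<Sum>i<g. if i = b then z $ c i * ?D else 0)"
      by (rule sum.cong) (use B b in auto)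
    also have "\<dots> = z $ c b * ?D" using b by simp
    finally show ?thesis by (simp add: u_def sum_component mult.commute)
  qed
  show ?thesis
  proof (cases "?D = 0")
    case True
    then show ?thesis by (simp add: rmod.span_zero)
  next
    case False
    have "u = 0"
    proof (rule ccontr)
      assume u0: "u \<noteq> 0"
      \<comment> \<open>the index \<open>Inr g\<close> stands for \<open>u\<close>\<close>
      define h where "h = case_sum (\<lambda>j. axis j 1) (\<lambda>a. if a < g then w a else u)"
      have "free_family h (S <+> {..<Suc g})"
        unfolding free_family_Plus[OF finite finite_lessThan]
      proof (intro allI impI)
        fix p :: "'m \<Rightarrow> ('n, 'k) mpoly" and d :: "nat \<Rightarrow> ('n, 'k) mpoly"
        assume "(\<Sum>j\<in>S. p j *s h (Inl j)) + (\<Sum>a<Suc g. d a *s h (Inr a)) = 0"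
        then have rel: "(\<Sum>j\<in>S. p j *s axis j 1) + ((\<Sum>a<g. d a *s w a) + d g *s u) = 0"
          by (simp add: h_def)
        define v where "v = (\<Sum>a<g. d a *s w a) + d g *s u"
        have vZ: "v \<in> diff_syzygies f"
          unfolding v_def
          by (intro rmod.subspace_add[OF diff_syzygies_subspace] rmod.subspace_scale[OF diff_syzygies_subspace]
            rmod.subspace_sum[OF diff_syzygies_subspace] uZ w) simp
        have pcomp: "(\<Sum>j\<in>S. p j *s axis j 1) $ i = (if i \<in> S then p i else 0)" for i
          by (simp add: sum_component axis_def if_distrib[of "\<lambda>x. _ * x"] sum.delta cong: if_cong)
        have rel_v: "(\<Sum>j\<in>S. p j *s axis j 1) + v = 0" using rel by (simp only: v_def)
        have pv: "(if i \<in> S then p i else 0) + v $ i = 0" for i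
          using arg_cong[OF rel_v, of "\<lambda>x. x $ i"]
          by (simp only: vector_add_component pcomp zero_index)
        then have v_out: "v $ i = 0" if "i \<notin> S" for i
          using pv[of i] that by simp
        have "(\<Sum>j\<in>S. v $ j *s differential (f $ j)) = (\<Sum>j\<in>UNIV. v $ j *s differential (f $ j))"
          by (rule sum.mono_neutral_left) (auto simp: v_out)
        also have "\<dots> = 0" using vZ by (simp add: diff_syzygies_def)
        finally have "(\<Sum>j\<in>S. v $ j *s differential (f $ j)) = 0" .
        then have v_in: "\<forall>j\<in>S. v $ j = 0"
          by (rule free_differentials_if_alg_indep[OF ind, unfolded free_family_def, THEN spec, THEN mp])
        then have v0: "v $ j = 0" for j using v_out by (cases "j \<in> S") auto
        have p0: "\<forall>j\<in>S. p j = 0"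
        proof
          fix j assume "j \<in> S"
          then show "p j = 0" using pv[of j] by (simp add: v0)
        qed
        have d0: "d a = 0" if "a < g" for a
        proof (rule det_nonzero_rows_free[OF False _ that])
          fix b assume b: "b < g"
          have "v $ c b = (\<Sum>a<g. d a * w a $ c b) + d g * u $ c b"
            by (simp add: v_def sum_component)
          then show "(\<Sum>a<g. d a * w a $ c b) = 0" by (simp add: v0 uc[OF b])
        qed
        have "v = d g *s u" unfolding v_def by (simp add: d0)
        then have du: "d g * u $ j = 0" for j using v0[of j] by simp
        obtain j where "u $ j \<noteq> 0" using u0 unfolding Finite_Cartesian_Product.vec_eq_iff by auto
        then have "d g = 0" using du[of j] by simp
        then show "(\<forall>j\<in>S. p j = 0) \<and> (\<forall>a\<in>{..<Suc g}. d a = 0)"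
          using p0 d0 by (auto simp: less_Suc_eq)
      qed
      then have "card (S <+> {..<Suc g}) \<le> CARD('m)"
        by (rule free_family_card_le[rotated]) simp
      then show False using card by (simp add: card_Plus)
    qed
    then show ?thesis using span by (simp add: u_def)
  qed
qed

section \<open>The Jacobian ideal\<close>

lemma psubst_minor:
  "psubst f (Determinant.det (Matrix.mat g g (\<lambda>(a, b). pderiv_var (c b) (r a)))) =
    Determinant.det (Matrix.mat g g (\<lambda>(a, b). polar_gradient f (r a) $ c b))"
proof -
  interpret comm_ring_hom "psubst f" by (rule comm_ring_hom_psubst)
  have "map_mat (psubst f) (Matrix.mat g g (\<lambda>(a, b). pderiv_var (c b) (r a))) =
      Matrix.mat g g (\<lambda>(a, b). polar_gradient f (r a) $ c b)"
    by (rule eq_matI) (auto simp: polar_gradient_def)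
  then show ?thesis using hom_det[of "Matrix.mat g g (\<lambda>(a, b). pderiv_var (c b) (r a))"] by simp
qed

text \<open>The unit vectors of \<open>S\<close> and the gradients of the generators span generically, since a least
  relation between \<open>S\<close> and a further index \<open>j\<close> has a gradient supported on \<open>S \<union> {j}\<close> that is nonzero
  at \<open>j\<close>. Extending the unit vectors to a basis selects \<open>g\<close> generators; the minor with their rows and
  the columns outside \<open>S\<close> is nonzero.\<close>

lemma nonzero_jacobian_minor:
  fixes f :: "('n::{finite,linorder}, 'k::field_char_0) mpoly ^ 'm::finite"
  assumes ind: "alg_indep {0} (\<lambda>j. f $ j) S"
    and max: "\<And>j. j \<notin> S \<Longrightarrow> \<not> alg_indep {0} (\<lambda>j. f $ j) (insert j S)"
    and card: "card S + g = CARD('m)" and gens: "ideal.span G = relation_ideal f"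
  shows "\<exists>\<Delta>\<in>jacobian_minors g G. psubst f \<Delta> \<noteq> 0"
proof -
  let ?e = "\<lambda>j. axis j 1 :: ('n, 'k) mpoly ^ 'm"
  let ?X = "?e ` S \<union> polar_gradient f ` G"
  have comp: "(\<Sum>j\<in>T. p j *s ?e j) $ i = (if i \<in> T then p i else 0)" for T p i
    by (simp add: sum_component axis_def if_distrib[of "\<lambda>x. _ * x"] sum.delta cong: if_cong)
  have free_e: "free_family ?e S"
    unfolding free_family_def
  proof (intro allI impI ballI)
    fix p i assume "(\<Sum>j\<in>S. p j *s ?e j) = 0" "i \<in> S"
    then show "p i = 0" using comp[where T = S and p = p and i = i] by simp
  qed
  have gen: "\<exists>b. b \<noteq> 0 \<and> b *s ?e j \<in> rmod.span ?X" for j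
  proof (cases "j \<in> S")
    case True
    then have "1 *s ?e j \<in> rmod.span ?X" by (intro rmod.span_scale rmod.span_base) simp
    then show ?thesis by (intro exI[of _ 1]) simp
  next
    case False
    obtain F where F: "F \<in> polys_in (insert j S)" "peval Const (\<lambda>j. f $ j) F = 0"
      "peval Const (\<lambda>j. f $ j) (pderiv_var j F) \<noteq> 0"
      using minimal_relation[OF ind max[OF False]] by blast
    let ?b = "polar_gradient f F"
    have b: "?b $ j \<noteq> 0" using F(3) by (simp add: polar_gradient_def psubst_eq_peval)
    have zero: "?b $ i = 0" if "i \<notin> insert j S" for i
      using pderiv_var_not_in[OF F(1) that]
      by (simp add: polar_gradient_def psubst_eq_peval peval_0[OF comm_ring_hom_Const])
    have "F \<in> relation_ideal f" using F(2) by (simp add: relation_ideal_def psubst_eq_peval)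
    then have "?b \<in> rmod.span (polar_gradient f ` G)"
      by (rule polar_gradient_in_span_generators[OF gens])
    then have "?b \<in> rmod.span ?X" by (rule subsetD[OF rmod.span_mono, rotated]) simp
    moreover have "(\<Sum>i\<in>S. ?b $ i *s ?e i) \<in> rmod.span ?X"
      by (intro rmod.span_sum rmod.span_scale rmod.span_base) simp
    ultimately have "?b - (\<Sum>i\<in>S. ?b $ i *s ?e i) \<in> rmod.span ?X" by (rule rmod.span_diff)
    moreover have "?b - (\<Sum>i\<in>S. ?b $ i *s ?e i) = ?b $ j *s ?e j"
      unfolding Finite_Cartesian_Product.vec_eq_iff
    proof
      fix i
      show "(?b - (\<Sum>i\<in>S. ?b $ i *s ?e i)) $ i = (?b $ j *s ?e j) $ i"
        unfolding vector_minus_component vector_smult_component comp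
        using False zero[of i] by (cases "i = j"; cases "i \<in> S") (auto simp: axis_def)
    qed
    ultimately show ?thesis using b by (intro exI[of _ "?b $ j"]) simp
  qed
  obtain B where B: "?e ` S \<subseteq> B" "B \<subseteq> ?X" "finite B" "card B = CARD('m)" "free_family (\<lambda>v. v) B"
    using free_family_extend_to_basis[OF finite free_e _ gen] by auto
  have inj_e: "inj_on ?e S" by (rule inj_onI) (simp add: axis_eq_axis)
  have "card (B - ?e ` S) = g"
    using B(1,4) card by (simp add: card_Diff_subset card_image[OF inj_e])
  then obtain w where w: "bij_betw w {0..<g} (B - ?e ` S)"
    using ex_bij_betw_nat_finite[of "B - ?e ` S"] B(3) by auto
  have "\<forall>a. \<exists>F. a < g \<longrightarrow> F \<in> G \<and> w a = polar_gradient f F"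
    using bij_betwE[OF w] B(2) by fastforce
  then obtain r where r: "\<And>a. a < g \<Longrightarrow> r a \<in> G \<and> w a = polar_gradient f (r a)" by metis
  have "card (- S) = g" using card by (simp add: Compl_eq_Diff_UNIV card_Diff_subset)
  then obtain c where c: "bij_betw c {0..<g} (- S)"
    using ex_bij_betw_nat_finite[of "- S"] by auto
  have r_inj: "inj_on r {..<g}"
  proof (rule inj_onI)
    fix a b assume ab: "a \<in> {..<g}" "b \<in> {..<g}" "r a = r b"
    then have "w a = w b" using r[of a] r[of b] by simp
    then show "a = b" by (rule inj_onD[OF bij_betw_imp_inj_on[OF w]]) (use ab in auto)
  qed
  define \<pi> where "\<pi> = case_sum ?e w"
  have "inj_on \<pi> (S <+> {..<g})"
  proof (rule inj_onI)
    fix x y assume xy: "x \<in> S <+> {..<g}" "y \<in> S <+> {..<g}" "\<pi> x = \<pi> y"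
    have ne: "w a \<noteq> ?e j" "?e j \<noteq> w a" if "a < g" "j \<in> S" for a j
      using bij_betwE[OF w] that by force+
    then show "x = y"
      using xy inj_onD[OF inj_e] inj_onD[OF bij_betw_imp_inj_on[OF w]] by (auto simp: \<pi>_def)
  qed
  moreover have "\<pi> ` (S <+> {..<g}) = B"
  proof -
    have "\<pi> ` (S <+> {..<g}) = ?e ` S \<union> w ` {0..<g}"
      by (auto simp: \<pi>_def Plus_def image_Un image_image lessThan_atLeast0)
    then show ?thesis using bij_betw_imp_surj_on[OF w] B(1) by auto
  qed
  ultimately have free: "free_family (\<lambda>i. \<pi> i) (S <+> {..<g})"
    using free_family_reindex[of \<pi> "S <+> {..<g}" "\<lambda>v. v"] B(5) by simp
  have "Determinant.det (Matrix.mat g g (\<lambda>(a, b). w a $ c b)) \<noteq> 0"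
  proof (rule rows_free_det_nonzero)
    fix d assume d: "\<And>b. b < g \<Longrightarrow> (\<Sum>a<g. d a * w a $ c b) = 0"
    \<comment> \<open>a relation between the rows on the columns outside \<open>S\<close> extends to one involving the unit vectors\<close>
    define v where "v = (\<Sum>a<g. d a *s w a)"
    have v_out: "v $ i = 0" if "i \<notin> S" for i
    proof -
      have "i \<in> c ` {0..<g}" using that bij_betw_imp_surj_on[OF c] by simp
      then obtain b where "b < g" "i = c b" by auto
      then show ?thesis using d by (simp add: v_def sum_component)
    qed
    have "(\<Sum>j\<in>S. (- v $ j) *s ?e j) + v = 0"
      unfolding Finite_Cartesian_Product.vec_eq_iff vector_add_component comp by (simp add: v_out)
    then have "(\<Sum>j\<in>S. (- v $ j) *s \<pi> (Inl j)) + (\<Sum>a<g. d a *s \<pi> (Inr a)) = 0"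
      by (simp add: \<pi>_def v_def)
    then have "(\<forall>j\<in>S. - v $ j = 0) \<and> (\<forall>a\<in>{..<g}. d a = 0)"
      by (rule free[unfolded free_family_Plus[OF finite finite_lessThan], THEN spec, THEN spec, THEN mp])
    then show "\<forall>a<g. d a = 0" by simp
  qed
  moreover have "Matrix.mat g g (\<lambda>(a, b). w a $ c b) =
      Matrix.mat g g (\<lambda>(a, b). polar_gradient f (r a) $ c b)"
    by (rule eq_matI) (use r in auto)
  ultimately have "psubst f (Determinant.det (Matrix.mat g g (\<lambda>(a, b). pderiv_var (c b) (r a)))) \<noteq> 0"
    unfolding psubst_minor by simp
  moreover have "Determinant.det (Matrix.mat g g (\<lambda>(a, b). pderiv_var (c b) (r a))) \<in> jacobian_minors g G"
    unfolding jacobian_minors_def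
    using r r_inj bij_betw_imp_inj_on[OF c]
    by (intro CollectI exI[of _ r] exI[of _ c]) (auto simp: lessThan_atLeast0)
  ultimately show ?thesis by blast
qed

text \<open>The Jacobian ideal is an ideal of the subalgebra only, so it is compared with the intersection of
  the subalgebra and the colon ideal, which is an ideal of the subalgebra as well.\<close>

lemma span_jacobian_ideal_subset:
  assumes "rmod.subspace D" "\<And>\<Delta> z. \<Delta> \<in> jacobian_minors (the_enat (height (relation_ideal f))) G \<Longrightarrow> z \<in> Z \<Longrightarrow> psubst f \<Delta> *s z \<in> D"
  shows "ideal.span (jacobian_ideal f G) \<subseteq> colon_ideal D Z"
proof (rule ideal.span_minimal)
  interpret h: comm_ring_hom "psubst f" by (rule comm_ring_hom_psubst)
  show sub: "ideal.subspace (colon_ideal D Z)"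
  proof (rule ideal.subspaceI)
    show "0 \<in> colon_ideal D Z"
      by (simp add: colon_ideal_def rmod.subspace_0[OF assms(1)])
  next
    fix x y assume "x \<in> colon_ideal D Z" "y \<in> colon_ideal D Z"
    then show "x + y \<in> colon_ideal D Z"
      by (simp add: colon_ideal_def vector_sadd_rdistrib rmod.subspace_add[OF assms(1)])
  next
    fix a x assume x: "x \<in> colon_ideal D Z"
    have "(a * x) *s z \<in> D" if "z \<in> Z" for z
    proof -
      have "x *s z \<in> D" using x that by (simp add: colon_ideal_def)
      then have "a *s (x *s z) \<in> D" by (rule rmod.subspace_scale[OF assms(1)])
      then show ?thesis by (simp only: vector_smult_assoc)
    qed
    then show "a * x \<in> colon_ideal D Z" by (simp add: colon_ideal_def)
  qed
  have "jacobian_ideal f G \<subseteq> gen_subalgebra f \<inter> colon_ideal D Z"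
    unfolding jacobian_ideal_def
  proof (rule hull_minimal)
    show "psubst f ` jacobian_minors (the_enat (height (relation_ideal f))) G
        \<subseteq> gen_subalgebra f \<inter> colon_ideal D Z"
      using assms(2) by (auto simp: gen_subalgebra_def colon_ideal_def)
    have A0: "0 \<in> gen_subalgebra f" unfolding gen_subalgebra_def by (rule range_eqI[of _ _ 0]) simp
    have A: "x + y \<in> gen_subalgebra f" "x * y \<in> gen_subalgebra f"
      if xy: "x \<in> gen_subalgebra f" "y \<in> gen_subalgebra f" for x y
    proof -
      obtain p q where "x = psubst f p" "y = psubst f q" using xy by (auto simp: gen_subalgebra_def)
      then have "x + y = psubst f (p + q)" "x * y = psubst f (p * q)" by (simp_all add: h.hom_add h.hom_mult)
      then show "x + y \<in> gen_subalgebra f" "x * y \<in> gen_subalgebra f" by (simp_all add: gen_subalgebra_def)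
    qed
    show "ideal_of_subring (gen_subalgebra f) (gen_subalgebra f \<inter> colon_ideal D Z)"
      unfolding ideal_of_subring_def
      by (intro conjI ballI IntI Int_lower1 A0 A ideal.subspace_0[OF sub] ideal.subspace_add[OF sub]
          ideal.subspace_scale[OF sub]) (simp_all only: Int_iff)
  qed
  then show "jacobian_ideal f G \<subseteq> colon_ideal D Z" by blast
qed

theorem corollary1p4:
  fixes f :: "('n::{finite,linorder}, 'k::field_char_0) mpoly ^ ('m::{finite,linorder})"
    and G :: "('m, 'k) mpoly set"
  assumes forms: "\<And>j. is_form (f $ j)"
    and gens: "module.span (*) G = relation_ideal f"
  shows "module.span (*) (jacobian_ideal f G)
      \<subseteq> colon_ideal (polar_syzygies f) (diff_syzygies f)
    \<and> (polarizable f \<longleftrightarrow>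
      colon_module (polar_syzygies f) (module.span (*) (jacobian_ideal f G)) = polar_syzygies f)"
proof -
  let ?J = "ideal.span (jacobian_ideal f G)"
  let ?D = "polar_syzygies f" and ?Z = "diff_syzygies f"
  obtain S where ind: "alg_indep {0} (\<lambda>j. f $ j) S"
    and max: "\<And>j. j \<notin> S \<Longrightarrow> \<not> alg_indep {0} (\<lambda>j. f $ j) (insert j S)"
    by (rule alg_indep_extend_to_maximal[OF alg_indep_empty, of "\<lambda>j. f $ j"]) blast
  define g where "g = CARD('m) - card S"
  have card: "card S + g = CARD('m)" using card_mono[of UNIV S] by (simp add: g_def)
  have height: "the_enat (height (relation_ideal f)) = g"
    using height_relation_ideal[OF ind max] by (simp add: g_def)
  have D_sub: "rmod.subspace ?D" unfolding polar_syzygies_eq by (rule rmod.subspace_span)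
  have grad_D: "polar_gradient f F \<in> ?D" if "F \<in> G" for F
    unfolding polar_syzygies_eq
    using ideal.span_base[OF that] unfolding gens by (intro rmod.span_base imageI)
  have JZ: "?J \<subseteq> colon_ideal ?D ?Z"
  proof (rule span_jacobian_ideal_subset[OF D_sub], unfold height)
    fix \<Delta> z assume "\<Delta> \<in> jacobian_minors g G" and z: "z \<in> ?Z"
    then obtain r c where \<Delta>: "\<Delta> = Determinant.det (Matrix.mat g g (\<lambda>(a, b). pderiv_var (c b) (r a)))"
      and r: "r ` {..<g} \<subseteq> G"
      unfolding jacobian_minors_def by blast
    let ?w = "\<lambda>a. polar_gradient f (r a)"
    have wD: "?w a \<in> ?D" if "a < g" for a using grad_D r that by auto
    then have "?w a \<in> ?Z" if "a < g" for a using polar_subset_diff_syzygies that by blast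
    then have "psubst f \<Delta> *s z \<in> rmod.span (?w ` {..<g})"
      unfolding \<Delta> psubst_minor by (rule det_scales_syzygy_into_span[OF ind card _ z])
    also have "rmod.span (?w ` {..<g}) \<subseteq> ?D"
      by (rule rmod.span_minimal[OF _ D_sub]) (use wD in auto)
    finally show "psubst f \<Delta> *s z \<in> ?D" .
  qed
  obtain \<Delta> where \<Delta>: "\<Delta> \<in> jacobian_minors g G" "psubst f \<Delta> \<noteq> 0"
    using nonzero_jacobian_minor[OF ind max card gens] by blast
  have "psubst f ` jacobian_minors g G \<subseteq> jacobian_ideal f G"
    unfolding jacobian_ideal_def height by (rule hull_subset)
  then have \<Delta>J: "psubst f \<Delta> \<in> ?J" using \<Delta>(1) by (intro ideal.span_base) blast
  have D_colon: "?D \<subseteq> colon_module ?D ?J"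
    using rmod.subspace_scale[OF D_sub] by (auto simp: colon_module_def)
  have "polarizable f \<longleftrightarrow> colon_module ?D ?J = ?D"
  proof
    assume "polarizable f"
    then have DZ: "?D = ?Z" by (simp add: polarizable_def)
    have "v \<in> ?Z" if "v \<in> colon_module ?D ?J" for v
      using that \<Delta>J diff_syzygies_cancel[OF \<Delta>(2)] unfolding colon_module_def DZ by blast
    then show "colon_module ?D ?J = ?D" using D_colon DZ by blast
  next
    assume colon: "colon_module ?D ?J = ?D"
    have "?Z \<subseteq> colon_module ?D ?J"
      using JZ unfolding colon_module_def colon_ideal_def by blast
    then show "polarizable f"
      unfolding polarizable_def colon using polar_subset_diff_syzygies by blast
  qed
  then show ?thesis using JZ by blast
qed

end
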